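(* Let $r\ge 1$ be an integer and let $f:[-1,1]\to\mathbb{R}$ be a function whose derivative $f^{(r-1)}$ is absolutely continuous on $[-1,1]$ and satisfies $f^{(r-1)}(t)=f^{(r-1)}(-1)+\int_{-1}^t g(y)\,dy$ for all $t\in[-1,1]$, for some absolutely integrable $g$ of bounded variation on $[-1,1]$. Let $V_r$ be the infimum of $\mathrm{Var}(g)$ over all such $g$. Let $n\ge r+1$, let $-1\le x_n<x_{n-1}<\cdots<x_1\le 1$ be any $n$ distinct points, and let $\ell_1,\dots,\ell_n$ be the associated Lagrange basis polynomials. Then the interpolation error $E_n[f](x)=f(x)-\sum_{j=1}^n f(x_j)\ell_j(x)$ satisfies $$\|E_n[f]\|_\infty\le \frac{\pi^r V_r}{(n-1)(n-2)\cdots(n-r)}\max_{1\le j\le n}\|\ell_j\|_\infty .$$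
   Context: For distinct nodes $x_1,\dots,x_n$ put $\omega_n(x)=\prod_{i=1}^n(x-x_i)$ and $\ell_k(x)=\frac{\omega_n(x)}{\omega_n'(x_k)(x-x_k)}$ (the Lagrange basis polynomials of degree $n-1$, with $\ell_k(x_j)=\delta_{kj}$). $\|\cdot\|_\infty$ is the supremum norm on $[-1,1]$; $\mathrm{Var}(g)$ is the total variation of $g$ on $[-1,1]$; $f^{(0)}=f$. *)

theory Defs
  imports "HOL-Analysis.Analysis" "HOL-Computational_Algebra.Polynomial"
begin

text \<open>Iterated derivatives of a function on \<^term>\<open>S\<close> are taken within \<^term>\<open>S\<close>, i.e. one-sidedly at the
  endpoints of a closed interval; so only the values of the function on \<^term>\<open>S\<close> matter.\<close>

primrec nth_deriv_on :: "real set \<Rightarrow> nat \<Rightarrow> (real \<Rightarrow> real) \<Rightarrow> real \<Rightarrow> real" where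
  "nth_deriv_on S 0 f = f"
| "nth_deriv_on S (Suc k) f = (\<lambda>x. vector_derivative (nth_deriv_on S k f) (at x within S))"

definition times_differentiable_on :: "nat \<Rightarrow> (real \<Rightarrow> real) \<Rightarrow> real set \<Rightarrow> bool" where
  "times_differentiable_on k f S \<longleftrightarrow> (\<forall>j<k. nth_deriv_on S j f differentiable_on S)"

definition absolutely_continuous_on_interval :: "real \<Rightarrow> real \<Rightarrow> (real \<Rightarrow> real) \<Rightarrow> bool" where
  "absolutely_continuous_on_interval a b h \<longleftrightarrow>
     (\<forall>\<epsilon>>0. \<exists>\<delta>>0. \<forall>(m::nat) u v.
        (\<forall>i<m. a \<le> u i \<and> u i \<le> v i \<and> v i \<le> b) \<longrightarrow>
        disjoint_family_on (\<lambda>i. {u i<..<v i}) {..<m} \<longrightarrow>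
        (\<Sum>i<m. v i - u i) < \<delta> \<longrightarrow>
        (\<Sum>i<m. \<bar>h (v i) - h (u i)\<bar>) < \<epsilon>)"

definition variation_sums :: "real \<Rightarrow> real \<Rightarrow> (real \<Rightarrow> real) \<Rightarrow> real set" where
  "variation_sums a b g =
     {(\<Sum>i<m. \<bar>g (t (Suc i)) - g (t i)\<bar>) | (m::nat) t.
        mono_on {..m} t \<and> t ` {..m} \<subseteq> {a..b}}"

definition bounded_variation_on :: "real \<Rightarrow> real \<Rightarrow> (real \<Rightarrow> real) \<Rightarrow> bool" where
  "bounded_variation_on a b g \<longleftrightarrow> bdd_above (variation_sums a b g)"

text \<open>Only meaningful for functions of bounded variation.\<close>

definition total_variation :: "real \<Rightarrow> real \<Rightarrow> (real \<Rightarrow> real) \<Rightarrow> real" where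
  "total_variation a b g = Sup (variation_sums a b g)"

text \<open>The admissible \<^term>\<open>g\<close>, i.e. the versions of the derivative of order \<^term>\<open>r\<close>; they may differ
  from each other on null sets, which changes their variation.\<close>

definition bv_densities :: "nat \<Rightarrow> (real \<Rightarrow> real) \<Rightarrow> (real \<Rightarrow> real) set" where
  "bv_densities r f =
     {g. g absolutely_integrable_on {-1..1} \<and> bounded_variation_on (-1) 1 g \<and>
         (\<forall>t\<in>{-1..1}. nth_deriv_on {-1..1} (r - 1) f t =
            nth_deriv_on {-1..1} (r - 1) f (-1) + integral {-1..t} g)}"

definition min_variation :: "nat \<Rightarrow> (real \<Rightarrow> real) \<Rightarrow> real" where
  "min_variation r f = (INF g\<in>bv_densities r f. total_variation (-1) 1 g)"

text \<open>Only meaningful for functions that are bounded on \<open>[-1,1]\<close>.\<close>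

definition sup_norm :: "(real \<Rightarrow> real) \<Rightarrow> real" where
  "sup_norm h = (SUP y\<in>{-1..1}. \<bar>h y\<bar>)"

definition nodal_poly :: "nat \<Rightarrow> (nat \<Rightarrow> real) \<Rightarrow> real poly" where
  "nodal_poly n x = (\<Prod>i=1..n. [:- x i, 1:])"

text \<open>Dividing as polynomials avoids the spurious value \<open>0 / 0 = 0\<close> at the node \<^term>\<open>x k\<close>.\<close>

definition lagrange_basis :: "nat \<Rightarrow> (nat \<Rightarrow> real) \<Rightarrow> nat \<Rightarrow> real poly" where
  "lagrange_basis n x k =
     smult (1 / poly (pderiv (nodal_poly n x)) (x k)) (nodal_poly n x div [:- x k, 1:])"

definition interp_error :: "nat \<Rightarrow> (nat \<Rightarrow> real) \<Rightarrow> (real \<Rightarrow> real) \<Rightarrow> real \<Rightarrow> real" where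
  "interp_error n x f y = f y - (\<Sum>j=1..n. f (x j) * poly (lagrange_basis n x j) y)"

lemma nodal_poly_div:
  assumes "k \<in> {1..n}"
  shows "nodal_poly n x = [:- x k, 1:] * (\<Prod>i\<in>{1..n}-{k}. [:- x i, 1:])"
    and "nodal_poly n x div [:- x k, 1:] = (\<Prod>i\<in>{1..n}-{k}. [:- x i, 1:])"
proof -
  show *: "nodal_poly n x = [:- x k, 1:] * (\<Prod>i\<in>{1..n}-{k}. [:- x i, 1:])"
    unfolding nodal_poly_def by (rule prod.remove) (use assms in auto)
  show "nodal_poly n x div [:- x k, 1:] = (\<Prod>i\<in>{1..n}-{k}. [:- x i, 1:])"
    unfolding * by (rule nonzero_mult_div_cancel_left) simp
qed

lemma poly_pderiv_nodal:
  assumes "k \<in> {1..n}"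
  shows "poly (pderiv (nodal_poly n x)) (x k) = (\<Prod>i\<in>{1..n}-{k}. x k - x i)"
proof -
  have "pderiv (nodal_poly n x) =
      [:- x k, 1:] * pderiv (\<Prod>i\<in>{1..n}-{k}. [:- x i, 1:])
      + (\<Prod>i\<in>{1..n}-{k}. [:- x i, 1:]) * pderiv [:- x k, 1:]"
    unfolding nodal_poly_div(1)[OF assms] by (rule pderiv_mult)
  then show ?thesis
    by (simp only: poly_add poly_mult poly_prod pderiv_pCons) simp
qed

lemma poly_lagrange_basis:
  assumes "k \<in> {1..n}" "y \<noteq> x k"
  shows "poly (lagrange_basis n x k) y =
    poly (nodal_poly n x) y / (poly (pderiv (nodal_poly n x)) (x k) * (y - x k))"
proof -
  have "poly (nodal_poly n x) y = (y - x k) * poly (\<Prod>i\<in>{1..n}-{k}. [:- x i, 1:]) y"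
    unfolding nodal_poly_div(1)[OF assms(1)] poly_mult by simp
  then show ?thesis
    unfolding lagrange_basis_def nodal_poly_div(2)[OF assms(1)] using assms(2) by simp
qed

lemma poly_lagrange_basis_node:
  assumes "k \<in> {1..n}" "j \<in> {1..n}" "inj_on x {1..n}"
  shows "poly (lagrange_basis n x k) (x j) = (if j = k then 1 else 0)"
proof -
  have nz: "(\<Prod>i\<in>{1..n}-{k}. x k - x i) \<noteq> 0"
    using assms by (subst prod_zero_iff) (auto dest: inj_onD)
  have z: "(\<Prod>i\<in>{1..n}-{k}. x j - x i) = 0" if "j \<noteq> k"
    using assms that by (intro prod_zero) auto
  have "poly (lagrange_basis n x k) (x j) =
      (\<Prod>i\<in>{1..n}-{k}. x j - x i) / (\<Prod>i\<in>{1..n}-{k}. x k - x i)"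
    unfolding lagrange_basis_def nodal_poly_div(2)[OF assms(1)] poly_pderiv_nodal[OF assms(1)]
      poly_smult poly_prod by simp
  then show ?thesis
    using nz z divide_self[OF nz] by (metis div_0)
qed

end

theory Submission
  imports Defs
begin

text \<open>Fix \<open>y\<close>. The error functional at \<open>y\<close> is a multiple of a divided difference, so it kills
  polynomials of degree below \<open>n\<close> and has Peano kernels \<open>K\<^sub>1(t) = E\<^sub>n[1\<^bsub>[t,1]\<^esub>](y)\<close> and
  \<open>K\<^bsub>s+1\<^esub>(t) = \<integral>\<^bsub>t\<^esub>\<^bsup>1\<^esup> K\<^sub>s\<close>. Moving \<open>t\<close> past a node flips the sign of \<open>K\<^sub>1\<close> and changes it by a Lagrange
  basis polynomial, hence \<open>\<bar>K\<^sub>1\<bar> \<le> max\<^sub>j \<bar>l\<^sub>j(y)\<bar>\<close>. As \<open>K\<^sub>s\<close> is orthogonal to the polynomials of degree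
  at most \<open>n - s - 1\<close>, \<open>K\<^bsub>s+1\<^esub>(t)\<close> is unchanged when the indicator of \<open>[t,1]\<close> is replaced by its
  difference to such a polynomial. Interpolation at Chebyshev points makes the \<open>L\<^sup>1\<close> norm of this
  difference explicit when \<open>t\<close> is itself a Chebyshev point, and a Lipschitz estimate in the angle
  gives \<open>\<bar>K\<^bsub>s+1\<^esub>\<bar> \<le> \<pi> / (n - s) \<cdot> sup \<bar>K\<^sub>s\<bar>\<close> everywhere. Finally \<open>E\<^sub>n[f](y) = \<integral> K\<^sub>r g\<close> is at most
  \<open>sup \<bar>K\<^bsub>r+1\<^esub>\<bar> \<cdot> Var g\<close> by the second mean value theorem applied to the two monotone parts of
  the Jordan decomposition of \<open>g\<close>.\<close>

section \<open>Divided differences and interpolation of step functions\<close>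

text \<open>The divided difference in its symmetric form. Indexing by a set rather than a list makes
  adding and removing single nodes easy.\<close>

definition divdiff :: "real set \<Rightarrow> (real \<Rightarrow> real) \<Rightarrow> real" where
  "divdiff A f = (\<Sum>a\<in>A. f a / (\<Prod>b\<in>A - {a}. a - b))"

text \<open>Set-indexed counterpart of \<open>lagrange_basis\<close>; it serves both for the given
  nodes and for the auxiliary Chebyshev points.\<close>

definition lagrange_poly :: "real set \<Rightarrow> real \<Rightarrow> real poly" where
  "lagrange_poly A a = (\<Prod>b\<in>A - {a}. smult (1 / (a - b)) [:- b, 1:])"

lemma poly_lagrange_poly: "poly (lagrange_poly A a) y = (\<Prod>b\<in>A - {a}. (y - b) / (a - b))"
  by (simp add: lagrange_poly_def poly_prod diff_divide_distrib)

lemma degree_lagrange_poly: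
  assumes "finite A" "a \<in> A"
  shows "degree (lagrange_poly A a) < card A"
proof -
  have "degree (lagrange_poly A a) \<le> (\<Sum>b\<in>A - {a}. degree (smult (1 / (a - b)) [:- b, 1:]))"
    unfolding lagrange_poly_def using degree_prod_sum_le[of "A - {a}" "\<lambda>b. smult (1 / (a - b)) [:- b, 1:]"] assms
    by (simp only: o_def finite_Diff)
  also have "\<dots> \<le> (\<Sum>b\<in>A - {a}. 1)"
    by (intro sum_mono) (auto intro: order_trans[OF degree_smult_le])
  also have "\<dots> < card A"
    using assms card_gt_0_iff[of A] by auto
  finally show ?thesis .
qed

text \<open>The factor \<open>x - d\<close> kills the term at \<open>d\<close> and cancels the
  factor \<open>a - d\<close> in every other denominator.\<close>

lemma divdiff_remove:
  assumes "finite A" "d \<in> A"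
  shows "divdiff (A - {d}) f = divdiff A (\<lambda>x. (x - d) * f x)"
proof -
  have "divdiff A (\<lambda>x. (x - d) * f x) = (\<Sum>a\<in>A - {d}. (a - d) * f a / (\<Prod>b\<in>A - {a}. a - b))"
    unfolding divdiff_def by (subst sum.remove[OF assms]) simp
  also have "\<dots> = divdiff (A - {d}) f"
    unfolding divdiff_def
  proof (rule sum.cong[OF refl])
    fix a assume a: "a \<in> A - {d}"
    have "(\<Prod>b\<in>A - {a}. a - b) = (a - d) * (\<Prod>b\<in>A - {a} - {d}. a - b)"
      using assms a by (intro prod.remove) auto
    moreover have "A - {a} - {d} = A - {d} - {a}" by auto
    ultimately show "(a - d) * f a / (\<Prod>b\<in>A - {a}. a - b) = f a / (\<Prod>b\<in>A - {d} - {a}. a - b)"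
      using a by simp
  qed
  finally show ?thesis ..
qed

lemma divdiff_add: "divdiff A (\<lambda>x. f x + g x) = divdiff A f + divdiff A g"
  by (simp add: divdiff_def add_divide_distrib sum.distrib)

lemma divdiff_cmult: "divdiff A (\<lambda>x. c * f x) = c * divdiff A f"
  by (simp add: divdiff_def sum_distrib_left)

lemma divdiff_cong: "(\<And>a. a \<in> A \<Longrightarrow> f a = g a) \<Longrightarrow> divdiff A f = divdiff A g"
  by (simp add: divdiff_def)

text \<open>Write \<open>c - d\<close> as \<open>(x - d) - (x - c)\<close> and remove one node with
  each factor. The undivided form also covers \<open>c = d\<close>.\<close>

lemma divdiff_recursion:
  assumes "finite A" "c \<in> A" "d \<in> A"
  shows "(c - d) * divdiff A f = divdiff (A - {d}) f - divdiff (A - {c}) f"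
proof -
  have "divdiff (A - {d}) f = divdiff A (\<lambda>x. (x - c) * f x + (c - d) * f x)"
    unfolding divdiff_remove[OF assms(1,3)] by (rule divdiff_cong) (simp add: algebra_simps)
  then show ?thesis
    unfolding divdiff_add divdiff_cmult divdiff_remove[OF assms(1,2)] by simp
qed

lemma divdiff_const:
  assumes "finite A" "card A \<ge> 2"
  shows "divdiff A (\<lambda>_. c) = 0"
  using assms
proof (induction "card A" arbitrary: A rule: less_induct)
  case less
  obtain x y where xy: "x \<in> A" "y \<in> A" "x \<noteq> y"
    using less.prems card_le_Suc0_iff_eq[of A] by fastforce
  \<comment> \<open>With two nodes, both remaining singletons have empty products as denominators
    and give the value \<open>c\<close>; with more nodes both sides vanish by induction.\<close>
  have "divdiff (A - {y}) (\<lambda>_. c) = divdiff (A - {x}) (\<lambda>_. c)"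
  proof (cases "card A = 2")
    case True
    then have "card (A - {x}) = 1" "card (A - {y}) = 1" using xy less.prems by auto
    then obtain z w where zw: "A - {x} = {z}" "A - {y} = {w}"
      by (metis One_nat_def card_1_singletonE)
    show ?thesis unfolding zw by (simp add: divdiff_def)
  next
    case False
    then have "card (A - {x}) \<ge> 2" "card (A - {y}) \<ge> 2" using xy less.prems by auto
    moreover have "card (A - {x}) < card A" "card (A - {y}) < card A"
      using xy less.prems by (auto intro!: psubset_card_mono)
    ultimately show ?thesis using less.hyps less.prems by simp
  qed
  then have "(x - y) * divdiff A (\<lambda>_. c) = 0"
    using divdiff_recursion[OF less.prems(1) xy(1,2)] by simp
  then show ?case using xy by simp
qed

text \<open>Split \<open>p\<close> as \<open>(x - d) * q + p(d)\<close>: the constant contributes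
  nothing, and the linear factor removes the node \<open>d\<close> while the degree drops by
  one.\<close>

lemma divdiff_poly:
  assumes "finite A" "degree p + 1 < card A"
  shows "divdiff A (poly p) = 0"
  using assms
proof (induction "degree p" arbitrary: A p rule: less_induct)
  case less
  obtain d where d: "d \<in> A" using less.prems by fastforce
  define q where "q = synthetic_div p d"
  have p: "poly p x = (x - d) * poly q x + poly p d" for x
    by (subst synthetic_div_correct'[of d p, symmetric]) (simp add: q_def algebra_simps)
  have "divdiff A (poly p) = divdiff A (\<lambda>x. (x - d) * poly q x) + divdiff A (\<lambda>_. poly p d)"
    unfolding divdiff_add[symmetric] by (rule divdiff_cong) (rule p)
  also have "divdiff A (\<lambda>_. poly p d) = 0"
    using less.prems by (intro divdiff_const) auto
  also have "divdiff A (\<lambda>x. (x - d) * poly q x) = divdiff (A - {d}) (poly q)"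
    by (rule divdiff_remove[symmetric]) (use less.prems d in auto)
  also have "\<dots> = 0"
  proof (cases "degree p = 0")
    case True
    then have "q = 0" by (simp add: q_def synthetic_div_eq_0_iff)
    then show ?thesis by (simp add: divdiff_def)
  next
    case False
    then show ?thesis
      using less.prems d by (intro less.hyps) (auto simp: q_def degree_synthetic_div)
  qed
  finally show ?case by simp
qed

text \<open>Apply the recursion to some \<open>c\<close> in \<open>U\<close> and \<open>d\<close>
  outside. Removing \<open>c\<close> changes the parity of \<open>card U\<close>, removing
  \<open>d\<close> does not, so the minus sign in the recursion makes both terms point the same
  way.\<close>

lemma divdiff_upper_set_sign:
  assumes "finite A" "A \<noteq> {}" "U \<subseteq> A" "\<And>u v. u \<in> U \<Longrightarrow> v \<in> A - U \<Longrightarrow> v < u"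
  shows "(-1) ^ card U * divdiff A (indicator U) \<le> 0"
  using assms
proof (induction "card A" arbitrary: A U rule: less_induct)
  case less
  note fin = \<open>finite A\<close>
  have finU: "finite U" using less.prems finite_subset by blast
  consider "U = {}" | "U = A" "card A = 1" | "U = A" "card A \<ge> 2" | c d where "c \<in> U" "d \<in> A - U"
  proof (cases "U = A")
    case True
    then show ?thesis using that less.prems
      by (metis One_nat_def Suc_1 card_0_eq le_less_linear less_Suc0 less_Suc_eq)
  qed (use less.prems that in blast)
  then show ?case
  proof cases
    case 1 then show ?thesis by (simp add: divdiff_def)
  next
    case 2 then show ?thesis by (auto simp: card_1_singleton_iff divdiff_def)
  next
    case 3
    then have "divdiff A (indicator U) = divdiff A (\<lambda>_. 1)" by (intro divdiff_cong) auto
    then show ?thesis using divdiff_const[OF fin 3(2)] by simp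
  next
    case (4 c d)
    have cA: "c \<in> A" using 4 less.prems by auto
    have cd: "d < c" using 4 less.prems by auto
    have "(-1) ^ card U * divdiff (A - {d}) (indicator U) \<le> 0"
      using less.prems 4 cA by (intro less.hyps) (auto simp: card_gt_0_iff)
    moreover have "(-1) ^ card (U - {c}) * divdiff (A - {c}) (indicator (U - {c})) \<le> 0"
      using less.prems 4 cA by (intro less.hyps) (auto simp: card_gt_0_iff)
    moreover have "divdiff (A - {c}) (indicator (U - {c})) = divdiff (A - {c}) (indicator U)"
      by (intro divdiff_cong) (auto simp: indicator_def)
    moreover have "(-1::real) ^ card U = - ((-1) ^ card (U - {c}))"
      using card.remove[OF finU 4(1)] by simp
    ultimately have "(-1) ^ card U * ((c - d) * divdiff A (indicator U)) \<le> 0"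
      unfolding divdiff_recursion[OF fin cA DiffD1[OF 4(2)]] by (simp add: algebra_simps)
    then have "(c - d) * ((-1) ^ card U * divdiff A (indicator U)) \<le> 0"
      by (simp add: mult.left_commute)
    then show ?thesis using cd by (simp add: mult_le_0_iff)
  qed
qed

text \<open>Passing to an adjacent upper set flips the sign, so the jump dominates both values.\<close>

lemma divdiff_upper_set_bound:
  assumes fin: "finite A" and "y \<in> A" "card A \<ge> 2" and U: "U \<subseteq> A"
    and up: "\<And>u v. u \<in> U \<Longrightarrow> v \<in> A - U \<Longrightarrow> v < u"
  shows "\<exists>a\<in>A - {y}. \<bar>divdiff A (indicator U)\<bar> \<le> 1 / \<bar>\<Prod>b\<in>A - {a}. a - b\<bar>"
proof -
  have adj: "\<bar>divdiff A (indicator V)\<bar> \<le> 1 / \<bar>\<Prod>b\<in>A - {a}. a - b\<bar>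
      \<and> \<bar>divdiff A (indicator (V - {a}))\<bar> \<le> 1 / \<bar>\<Prod>b\<in>A - {a}. a - b\<bar>"
    if V: "V \<subseteq> A" "a \<in> V" "\<And>u v. u \<in> V \<Longrightarrow> v \<in> A - V \<Longrightarrow> v < u"
      "\<And>u v. u \<in> V - {a} \<Longrightarrow> v \<in> A - (V - {a}) \<Longrightarrow> v < u" for V a
  proof -
    have finV: "finite V" using V fin finite_subset by blast
    have "A \<noteq> {}" using assms by auto
    then have s: "(-1) ^ card V * divdiff A (indicator V) \<le> 0"
      "(-1) ^ card (V - {a}) * divdiff A (indicator (V - {a})) \<le> 0"
      by (safe intro!: divdiff_upper_set_sign) (use V fin in blast)+
    have "divdiff A (indicator V) = divdiff A (\<lambda>x. indicator (V - {a}) x + indicator {a} x)"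
      by (rule divdiff_cong) (use V in \<open>auto simp: indicator_def\<close>)
    also have "\<dots> = divdiff A (indicator (V - {a})) + divdiff A (indicator {a})"
      by (rule divdiff_add)
    also have "divdiff A (indicator {a}) = 1 / (\<Prod>b\<in>A - {a}. a - b)"
      unfolding divdiff_def using fin V by (subst sum.remove[of _ a]) (auto intro!: sum.neutral)
    finally have e: "divdiff A (indicator V) = divdiff A (indicator (V - {a})) + 1 / (\<Prod>b\<in>A - {a}. a - b)" .
    have "(-1::real) ^ card V = - ((-1) ^ card (V - {a}))"
      using card.remove[OF finV V(2)] by simp
    then have "\<bar>1 / (\<Prod>b\<in>A - {a}. a - b)\<bar> = \<bar>divdiff A (indicator V)\<bar> + \<bar>divdiff A (indicator (V - {a}))\<bar>"
    proof -
      have c: "c = - d \<Longrightarrow> c * p \<le> 0 \<Longrightarrow> d * q \<le> 0 \<Longrightarrow> p = q + w \<Longrightarrow> d = 1 \<or> d = -1 \<Longrightarrow> \<bar>w\<bar> = \<bar>p\<bar> + \<bar>q\<bar>"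
        for c d p q w :: real by auto
      assume "(-1::real) ^ card V = - ((-1) ^ card (V - {a}))"
      from c[OF this s e] show ?thesis
        by (metis minus_one_power_iff)
    qed
    then show ?thesis by simp
  qed
  have ne: "A - {y} \<noteq> {}"
  proof
    assume "A - {y} = {}"
    then have "card A \<le> card {y}" by (intro card_mono) auto
    then show False using assms(3) by simp
  qed
  consider "U = {}" | "U = A" | "U \<noteq> {}" "U \<noteq> A" by blast
  then show ?thesis
  proof cases
    case 1 then show ?thesis using ne by (auto simp: divdiff_def)
  next
    case 2
    then have "divdiff A (indicator U) = divdiff A (\<lambda>_. 1)" by (intro divdiff_cong) auto
    then show ?thesis using divdiff_const[OF fin assms(3)] ne by auto
  next
    case 3
    \<comment> \<open>The two upper sets adjacent to \<open>U\<close> arise by dropping its least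
      node \<open>u\<close> or adding the greatest missing node \<open>v\<close>. The jump must not
      sit at \<open>y\<close>, where its weight is not tied to a Lagrange polynomial; at most one of
      \<open>u\<close>, \<open>v\<close> equals \<open>y\<close>.\<close>
    define u v where "u = Min U" and "v = Max (A - U)"
    have finU: "finite U" using U fin finite_subset by blast
    have u: "u \<in> U" "\<And>w. w \<in> U \<Longrightarrow> u \<le> w" using finU 3 by (auto simp: u_def)
    have ne': "A - U \<noteq> {}" using 3 U by auto
    have v: "v \<in> A - U" "\<And>w. w \<in> A - U \<Longrightarrow> w \<le> v" using fin Max_in[OF _ ne'] by (auto simp: v_def)
    show ?thesis
    proof (cases "u = y")
      case False
      have "w < z" if "z \<in> U - {u}" "w \<in> A - (U - {u})" for w z
        by (cases "w = u") (use that u(2)[of z] up[of z w] in auto)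
      then show ?thesis using adj[of U u] U u up False by (intro bexI[of _ u]) auto
    next
      case True
      then have "v \<noteq> y" using u v by auto
      moreover have "w < z" if "z \<in> insert v U" "w \<in> A - insert v U" for w z
        by (cases "z = v") (use that v(2)[of w] up[of z w] in auto)
      moreover have "insert v U - {v} = U" using v by auto
      ultimately show ?thesis using adj[of "insert v U" v] U v up by (intro bexI[of _ v]) auto
    qed
  qed
qed

text \<open>For \<open>a\<close> in \<open>A\<close> the denominator over \<open>insert y A\<close>
  has the extra factor \<open>a - y\<close>. It cancels against \<open>y - a\<close> in the nodal
  product and leaves minus the Lagrange value, while the term at \<open>y\<close> gives
  \<open>f y\<close>.\<close>

lemma interpolation_error_divdiff:
  assumes "finite A" "y \<notin> A"
  shows "f y - (\<Sum>a\<in>A. f a * poly (lagrange_poly A a) y) = (\<Prod>a\<in>A. y - a) * divdiff (insert y A) f"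
proof -
  have nz: "(\<Prod>a\<in>A. y - a) \<noteq> 0" using assms by auto
  have "(\<Prod>a\<in>A. y - a) * (f a / (\<Prod>b\<in>insert y A - {a}. a - b)) = - (f a * poly (lagrange_poly A a) y)"
    if a: "a \<in> A" for a
  proof -
    have "(\<Prod>b\<in>insert y A - {a}. a - b) = (a - y) * (\<Prod>b\<in>A - {a}. a - b)"
      using assms a by (subst insert_Diff_if) auto
    moreover have "(\<Prod>a\<in>A. y - a) = (y - a) * (\<Prod>b\<in>A - {a}. y - b)"
      using assms a by (intro prod.remove) auto
    moreover have "d * P * (u / (- d * Q)) = - (u * (P / Q))" if "d \<noteq> 0" for d P Q u :: real
      using that by simp
    from this[of "y - a"] have "(y - a) * P * (u / ((a - y) * Q)) = - (u * (P / Q))" for P Q u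
      using assms a by (metis minus_diff_eq right_minus_eq)
    ultimately show ?thesis
      by (simp only: poly_lagrange_poly prod_dividef)
  qed
  then have "(\<Prod>a\<in>A. y - a) * divdiff (insert y A) f
     = (\<Prod>a\<in>A. y - a) * (f y / (\<Prod>a\<in>A. y - a)) + (\<Sum>a\<in>A. - (f a * poly (lagrange_poly A a) y))"
    using assms by (simp add: divdiff_def sum_distrib_left distrib_left)
  then show ?thesis using nz by (simp add: sum_negf)
qed

text \<open>The error is the nodal product times a divided difference, so another copy of the
  product yields a square. The upper set contains \<open>y\<close> exactly when
  \<open>t < y\<close>, so its parity flips together with the sign of \<open>y - t\<close>.\<close>

lemma step_interpolation_sign:
  assumes fin: "finite A" and t: "t \<notin> A" and y: "y \<notin> A" "y \<noteq> t"
  shows "0 \<le> (-1) ^ card {a\<in>A. t < a} * (\<Prod>a\<in>insert t A. y - a) *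
    (indicator {t<..} y - (\<Sum>a\<in>{a\<in>A. t < a}. poly (lagrange_poly A a) y))"
proof -
  define U where "U = {a\<in>insert y A. t < a}"
  define D where "D = divdiff (insert y A) (indicator U)"
  have "indicator {t<..} y - (\<Sum>a\<in>{a\<in>A. t < a}. poly (lagrange_poly A a) y)
     = indicator U y - (\<Sum>a\<in>A. indicator U a * poly (lagrange_poly A a) y)"
    using fin by (simp add: U_def indicator_def of_bool_def sum.inter_filter if_distrib[of "\<lambda>c. c * _"] cong: if_cong)
  also have "\<dots> = (\<Prod>a\<in>A. y - a) * D"
    unfolding D_def by (rule interpolation_error_divdiff) (use fin y in auto)
  finally have e: "indicator {t<..} y - (\<Sum>a\<in>{a\<in>A. t < a}. poly (lagrange_poly A a) y) = (\<Prod>a\<in>A. y - a) * D" .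
  have s: "(-1) ^ card U * D \<le> 0"
    unfolding D_def by (rule divdiff_upper_set_sign) (use fin t y in \<open>auto simp: U_def\<close>)
  have "0 \<le> (-1) ^ card {a\<in>A. t < a} * (y - t) * D"
  proof (cases "t < y")
    case True
    then have "U = insert y {a\<in>A. t < a}" by (auto simp: U_def)
    then have "card U = Suc (card {a\<in>A. t < a})" using fin y by simp
    then show ?thesis using s True mult_nonneg_nonneg[of "y - t" "- ((-1) ^ card U * D)"] by (simp add: algebra_simps)
  next
    case False
    then have "U = {a\<in>A. t < a}" by (auto simp: U_def)
    then show ?thesis using s False mult_nonneg_nonneg[of "t - y" "- ((-1) ^ card U * D)"] by (simp add: algebra_simps)
  qed
  then have "0 \<le> (\<Prod>a\<in>A. y - a)\<^sup>2 * ((-1) ^ card {a\<in>A. t < a} * (y - t) * D)" by simp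
  then show ?thesis unfolding e using fin t by (simp add: power2_eq_square algebra_simps)
qed

section \<open>Approximation of step functions at Chebyshev points\<close>

text \<open>After multiplication by \<open>cos (\<alpha> / 2)\<close> each difference of cosines
  becomes a sum of two neighbouring sines, and the alternating sum telescopes.\<close>

lemma alternating_cos_sum:
  "(\<Sum>k<i. (-1) ^ k * (cos (real k * \<alpha>) - cos (real (Suc k) * \<alpha>))) * cos (\<alpha> / 2)
     = - ((-1) ^ i * sin (\<alpha> / 2) * sin (real i * \<alpha>))"
proof (induction i)
  case (Suc i)
  have *: "(cos (real i * \<alpha>) - cos (real (Suc i) * \<alpha>)) * cos (\<alpha> / 2)
     = sin (\<alpha> / 2) * (sin (real (Suc i) * \<alpha>) + sin (real i * \<alpha>))"
  proof -
    define \<beta> where "\<beta> = (real i + 1 / 2) * \<alpha>"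
    have "real i * \<alpha> = \<beta> - \<alpha> / 2" "real (Suc i) * \<alpha> = \<beta> + \<alpha> / 2"
      by (simp_all add: \<beta>_def algebra_simps)
    then show ?thesis by (simp only: cos_diff cos_add sin_diff sin_add) (simp add: algebra_simps)
  qed
  have "(-1) ^ i * ((cos (real i * \<alpha>) - cos (real (Suc i) * \<alpha>)) * cos (\<alpha> / 2))
     = (-1) ^ i * (sin (\<alpha> / 2) * (sin (real (Suc i) * \<alpha>) + sin (real i * \<alpha>)))"
    by (simp only: *)
  then show ?case
    using Suc.IH unfolding sum.lessThan_Suc distrib_right by (simp add: algebra_simps)
qed simp

text \<open>Polynomials in \<open>cos x\<close> of degree below \<open>N\<close> reduce to
  \<open>cos (j * x)\<close> with \<open>j < N\<close>. For these the closed form contains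
  \<open>sin (j * pi) = 0\<close>, and the factor \<open>cos (\<alpha> / 2)\<close> can be divided
  out because \<open>j < N\<close>.\<close>

lemma alternating_chebyshev_sum:
  assumes "degree p < N"
  shows "(\<Sum>k<N. (-1) ^ k * (poly p (cos (real k * (pi / N))) - poly p (cos (real (Suc k) * (pi / N))))) = 0"
proof -
  define \<Phi> :: "(real \<Rightarrow> real) \<Rightarrow> real" where
    "\<Phi> g = (\<Sum>k<N. (-1) ^ k * (g (real k * (pi / N)) - g (real (Suc k) * (pi / N))))" for g
  have add: "\<Phi> (\<lambda>x. f x + g x) = \<Phi> f + \<Phi> g" for f g
    by (simp add: \<Phi>_def sum.distrib[symmetric] algebra_simps)
  have cmult: "\<Phi> (\<lambda>x. c * g x) = c * \<Phi> g" for g c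
    by (simp add: \<Phi>_def sum_distrib_left algebra_simps)
  have N: "N > 0" using assms by simp
  have cos0: "\<Phi> (\<lambda>x. cos (real j * x)) = 0" if "j < N" for j
  proof -
    define \<alpha> where "\<alpha> = real j * (pi / N)"
    have "\<Phi> (\<lambda>x. cos (real j * x)) = (\<Sum>k<N. (-1) ^ k * (cos (real k * \<alpha>) - cos (real (Suc k) * \<alpha>)))"
      unfolding \<Phi>_def \<alpha>_def by (simp only: mult.left_commute[of "real j"])
    moreover have "real N * \<alpha> = real j * pi" using N by (simp add: \<alpha>_def)
    ultimately have "\<Phi> (\<lambda>x. cos (real j * x)) * cos (\<alpha> / 2) = 0"
      by (simp only: alternating_cos_sum) simp
    moreover have "cos (\<alpha> / 2) > 0"
      using that N by (intro cos_gt_zero_pi) (auto simp: \<alpha>_def field_simps intro: less_le_trans[of _ 0])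
    ultimately show ?thesis by simp
  qed
  \<comment> \<open>The extra factor \<open>cos (j * x)\<close> makes the induction work: the
    product formula trades a power of \<open>cos x\<close> for a shift of \<open>j\<close> by one,
    which preserves \<open>d + j < N\<close>.\<close>
  have pow: "\<Phi> (\<lambda>x. cos x ^ d * cos (real j * x)) = 0" if "d + j < N" for d j
    using that
  proof (induction d arbitrary: j)
    case 0
    then show ?case using cos0 by simp
  next
    case (Suc d)
    show ?case
    proof (cases j)
      case 0
      have "\<Phi> (\<lambda>x. cos x ^ d * cos (real 1 * x)) = 0"
        using Suc 0 by (intro Suc.IH) auto
      then show ?thesis using 0 by (simp add: mult.commute)
    next
      case (Suc i)
      have "cos x ^ Suc d * cos (real j * x)
          = (1/2) * (cos x ^ d * cos (real (Suc j) * x) + cos x ^ d * cos (real i * x))" for x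
      proof -
        have "real (Suc j) * x = real j * x + x" "real i * x = real j * x - x"
          by (simp_all add: Suc algebra_simps)
        then show ?thesis by (simp only: cos_add cos_diff) (simp add: algebra_simps)
      qed
      then have "\<Phi> (\<lambda>x. cos x ^ Suc d * cos (real j * x))
         = (1/2) * (\<Phi> (\<lambda>x. cos x ^ d * cos (real (Suc j) * x)) + \<Phi> (\<lambda>x. cos x ^ d * cos (real i * x)))"
        by (simp only: add cmult)
      also have "\<dots> = 0"
        using Suc.IH[of "Suc j"] Suc.IH[of i] Suc.prems Suc by simp
      finally show ?thesis .
    qed
  qed
  have "\<Phi> (\<lambda>x. \<Sum>i\<in>I. c i * cos x ^ i) = 0" if "finite I" "\<And>i. i \<in> I \<Longrightarrow> i < N" for I and c :: "nat \<Rightarrow> real"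
    using that
  proof (induction I rule: finite_induct)
    case empty
    then show ?case by (simp add: \<Phi>_def)
  next
    case (insert i I)
    have "\<Phi> (\<lambda>x. c i * cos x ^ i) = 0"
      using pow[of i 0] insert.prems by (simp add: cmult)
    then show ?case using insert by (simp add: add)
  qed
  from this[of "{..degree p}" "coeff p"] assms show ?thesis
    by (simp add: \<Phi>_def poly_altdef)
qed

section \<open>Antiderivatives of polynomials, integrable products and integrals over adjacent
  intervals\<close>

lemma poly_antiderivative:
  fixes q :: "real poly"
  shows "\<exists>Q. pderiv Q = q \<and> degree Q \<le> Suc (degree q)"
proof (intro exI conjI)
  let ?Q = "\<Sum>i\<le>degree q. monom (coeff q i / real (Suc i)) (Suc i)"
  have "pderiv ?Q = (\<Sum>i\<le>degree q. monom (coeff q i) i)"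
    by (simp add: higher_pderiv_sum[of 1, simplified] pderiv_monom del: of_nat_Suc)
  then show "pderiv ?Q = q" by (simp add: poly_as_sum_of_monoms)
  show "degree ?Q \<le> Suc (degree q)"
    by (intro degree_sum_le) (auto intro: order_trans[OF degree_monom_le])
qed

lemma has_integral_poly_pderiv:
  assumes "a \<le> (b::real)"
  shows "(poly (pderiv Q) has_integral (poly Q b - poly Q a)) {a..b}"
  using assms
  by (intro fundamental_theorem_of_calculus)
     (auto simp: has_real_derivative_iff_has_vector_derivative[symmetric] intro: DERIV_subset[OF poly_DERIV])

text \<open>Gauge integrability alone does not pass to products. Boundedness upgrades it to absolute
  integrability, hence measurability, and a bounded measurable factor preserves absolute
  integrability.\<close>

lemma integrable_bounded_mult:
  fixes f g :: "real \<Rightarrow> real"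
  assumes "f integrable_on {a..b}" "bounded (f ` {a..b})" "g integrable_on {a..b}" "bounded (g ` {a..b})"
  shows "(\<lambda>x. f x * g x) integrable_on {a..b}"
proof -
  have ai: "h absolutely_integrable_on {a..b}" if h: "h integrable_on {a..b}" "bounded (h ` {a..b})"
    for h :: "real \<Rightarrow> real"
  proof -
    obtain C where "\<forall>y\<in>h ` {a..b}. norm y \<le> C"
      using h(2) unfolding bounded_iff by blast
    then show ?thesis
      using h(1) by (intro absolutely_integrable_integrable_bound[of _ _ "\<lambda>_. C"]) auto
  qed
  have "f \<in> borel_measurable (lebesgue_on {a..b})"
    using ai[OF assms(1,2)] by (intro absolutely_integrable_imp_borel_measurable) auto
  then have "(\<lambda>x. f x * g x) absolutely_integrable_on {a..b}"
    using ai[OF assms(3,4)] assms(2) by (intro absolutely_integrable_bounded_measurable_product_real) auto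
  then show ?thesis by (rule set_lebesgue_integral_eq_integral)
qed

lemma bounded_poly_Icc: "bounded (poly p ` {a..b::real})"
  by (intro compact_imp_bounded compact_continuous_image continuous_intros) auto

text \<open>The points decrease, as cosines of increasing angles do; the order of the end points is
  carried along for combining intervals.\<close>

lemma has_integral_consecutive:
  fixes f :: "real \<Rightarrow> real"
  assumes "\<And>k. k < K \<Longrightarrow> z (Suc k) \<le> z k"
    and "\<And>k. k < K \<Longrightarrow> (f has_integral c k) {z (Suc k)..z k}"
  shows "(f has_integral (\<Sum>k<K. c k)) {z K..z 0} \<and> z K \<le> z 0"
  using assms
proof (induction K)
  case (Suc K)
  then have IH: "(f has_integral (\<Sum>k<K. c k)) {z K..z 0}" "z K \<le> z 0" by auto
  have "(f has_integral (c K + (\<Sum>k<K. c k))) {z (Suc K)..z 0}"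
    using Suc.prems IH by (intro has_integral_combine[of "z (Suc K)" "z K"]) auto
  then show ?case using IH Suc.prems(1)[of K] by (simp add: add.commute)
qed auto

text \<open>The step function at a Chebyshev point minus its interpolant at the other Chebyshev points
  changes sign at exactly these points, so its \<open>L\<^sup>1\<close> norm is an alternating sum to which the
  interpolant contributes nothing.\<close>

lemma step_approximation:
  fixes m i :: nat
  defines "z \<equiv> \<lambda>k. cos (real k * (pi / real (m + 2)))"
  assumes i: "1 \<le> i" "i \<le> m + 1"
  shows "\<exists>S. degree S \<le> m \<and> ((\<lambda>y. \<bar>indicator {z i<..} y - poly S y\<bar>) has_integral
     tan (pi / real (m + 2) / 2) * sin (real i * (pi / real (m + 2)))) {-1..1}"
proof -
  define N \<delta> where "N = m + 2" and "\<delta> = pi / N"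
  have N\<delta>: "real N * \<delta> = pi" "N > 0" "\<delta> > 0" by (auto simp: \<delta>_def N_def)
  have z: "z k = cos (real k * \<delta>)" for k by (simp add: z_def \<delta>_def N_def)
  have le_pi: "real k * \<delta> \<le> pi" if "k \<le> N" for k
    using N\<delta> that by (metis mult_right_mono of_nat_le_iff less_imp_le)
  have mono: "z k < z j" if "j < k" "k \<le> N" for j k
    unfolding z using that N\<delta> le_pi[of k] by (intro cos_monotone_0_pi) auto
  have inj: "inj_on z {..N}"
    by (rule inj_onI) (metis atMost_iff linorder_neqE_nat mono order_less_irrefl)
  have z0: "z 0 = 1" "z N = -1" by (auto simp: z N\<delta>)
  \<comment> \<open>The points \<open>z 1\<close>, ..., \<open>z (m+1)\<close> are the zeros of the
    Chebyshev polynomial of the second kind of degree \<open>m + 1\<close>. The jump sits at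
    \<open>z i\<close>; the other \<open>m\<close> points are the nodes of the interpolant
    \<open>S\<close>.\<close>
  define A where "A = z ` ({1..m+1} - {i})"
  define S where "S = (\<Sum>a\<in>{a\<in>A. z i < a}. lagrange_poly A a)"
  define W where "W y = indicator {z i<..} y - poly S y" for y
  have finA: "finite A" by (simp add: A_def)
  have zA: "z j \<in> A \<longleftrightarrow> j \<in> {1..m+1} - {i}" if "j \<le> N" for j
    unfolding A_def using that inj by (subst inj_on_image_mem_iff[OF inj]) (auto simp: N_def)
  have cardA: "card A = m"
    unfolding A_def using i by (subst card_image) (auto intro: inj_on_subset[OF inj] simp: N_def)
  have insA: "insert (z i) A = z ` {1..m+1}" unfolding A_def using i by auto
  have cardU: "card {a\<in>A. z i < a} = i - 1"
  proof -
    have "z i < z j \<longleftrightarrow> j < i" if "j \<le> N" for j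
      using i that mono[of j i] mono[of i j] by (cases j i rule: linorder_cases) (auto simp: N_def)
    then have "{a\<in>A. z i < a} = z ` {j\<in>{1..m+1} - {i}. j < i}"
      unfolding A_def by (auto simp: N_def)
    also have "{j\<in>{1..m+1} - {i}. j < i} = {1..<i}" using i by auto
    finally have "{a\<in>A. z i < a} = z ` {1..<i}" .
    then show ?thesis using i by (simp add: card_image inj_on_subset[OF inj] N_def subset_eq)
  qed
  have degS: "degree S \<le> m"
    unfolding S_def using finA cardA degree_lagrange_poly[OF finA] by (intro degree_sum_le) (auto simp: less_imp_le)
  obtain Q where Q: "pderiv Q = S" "degree Q \<le> Suc (degree S)" using poly_antiderivative by blast
  \<comment> \<open>The signed integral of \<open>W\<close> between \<open>z (Suc k)\<close> and
    \<open>z k\<close>, where the step equals \<open>of_bool (k < i)\<close>. The sign reflects the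
    \<open>i - 1\<close> nodes of \<open>A\<close> above the jump and the \<open>k\<close> interior
    Chebyshev points above the interval.\<close>
  define c where "c k = (-1) ^ (i - 1) * ((-1) ^ k * (of_bool (k < i) * (z k - z (Suc k)) - (poly Q (z k) - poly Q (z (Suc k)))))" for k
  have piece: "((\<lambda>y. \<bar>W y\<bar>) has_integral c k) {z (Suc k)..z k}" if k: "k < N" for k
  proof -
    have zk: "z (Suc k) \<le> z k" using mono[of k "Suc k"] k by simp
    have "((\<lambda>y. of_bool (k < i) - poly S y) has_integral
        (of_bool (k < i) * (z k - z (Suc k)) - (poly Q (z k) - poly Q (z (Suc k))))) {z (Suc k)..z k}"
      using has_integral_const_real[of "of_bool (k < i) :: real" "z (Suc k)" "z k"]
        has_integral_poly_pderiv[OF zk, of Q] zk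
      by (intro has_integral_diff) (auto simp: Q mult.commute)
    then have *: "((\<lambda>y. (-1) ^ (i - 1) * ((-1) ^ k * (of_bool (k < i) - poly S y))) has_integral c k) {z (Suc k)..z k}"
      unfolding c_def by (intro has_integral_mult_right)
    show ?thesis
    proof (rule has_integral_spike_finite[OF _ _ *])
      show "finite {z k, z (Suc k)}" by simp
      fix y assume "y \<in> {z (Suc k)..z k} - {z k, z (Suc k)}"
      then have y: "z (Suc k) < y" "y < z k" by auto
      have above: "y < z j" if "j \<le> k" for j
        using y mono[of j k] k that by (cases "j = k") auto
      have below: "z j < y" if "k < j" "j \<le> N" for j
        using y mono[of "Suc k" j] that by (cases "j = Suc k") auto
      have ynot: "y \<noteq> z j" if "j \<le> N" for j
        using above[of j] below[of j] that by (cases "j \<le> k") auto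
      have ind: "indicator {z i<..} y = (of_bool (k < i) :: real)"
        using above[of i] below[of i] i by (cases "k < i") (auto simp: N_def)
      have yA: "y \<notin> A"
      proof
        assume "y \<in> A"
        then obtain j where "j \<in> {1..m+1}" "y = z j" unfolding A_def by blast
        then show False using ynot[of j] by (simp add: N_def)
      qed
      have "0 \<le> (-1) ^ card {a\<in>A. z i < a} * (\<Prod>a\<in>insert (z i) A. y - a) *
          (indicator {z i<..} y - (\<Sum>a\<in>{a\<in>A. z i < a}. poly (lagrange_poly A a) y))"
        using i zA[of i] ynot[of i] yA by (intro step_interpolation_sign finA) (auto simp: N_def)
      then have s: "0 \<le> (-1) ^ (i - 1) * (\<Prod>a\<in>insert (z i) A. y - a) * W y"
        by (simp add: W_def S_def poly_sum cardU)
      have "(\<Prod>a\<in>insert (z i) A. y - a) = (\<Prod>j\<in>{1..m+1}. y - z j)"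
        unfolding insA by (subst prod.reindex) (auto intro: inj_on_subset[OF inj] simp: N_def)
      \<comment> \<open>Exactly the factors with \<open>j \<le> k\<close> are negative, since
        \<open>y\<close> lies strictly between \<open>z (Suc k)\<close> and
        \<open>z k\<close>.\<close>
      also have "\<dots> = (\<Prod>j\<in>{1..m+1}. (if j \<le> k then -1 else 1) * \<bar>y - z j\<bar>)"
        by (intro prod.cong) (use above below in \<open>auto simp: N_def not_le less_imp_le\<close>)
      also have "\<dots> = (-1) ^ k * (\<Prod>j\<in>{1..m+1}. \<bar>y - z j\<bar>)"
      proof -
        have "(\<Prod>j\<in>{1..m+1}. if j \<le> k then -1 else 1 :: real) = (\<Prod>j\<in>{1..k}. -1)"
          using k by (intro prod.mono_neutral_cong_right) (auto simp: N_def)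
        then show ?thesis by (simp add: prod.distrib)
      qed
      finally have s2: "0 \<le> ((-1) ^ (i - 1) * ((-1) ^ k * W y)) * (\<Prod>j\<in>{1..m+1}. \<bar>y - z j\<bar>)"
        using s by (simp add: algebra_simps)
      moreover have "(\<Prod>j\<in>{1..m+1}. \<bar>y - z j\<bar>) > 0"
        using ynot by (intro prod_pos) (auto simp: N_def)
      ultimately have s3: "0 \<le> (-1) ^ (i - 1) * ((-1) ^ k * W y)"
        by (metis mult_neg_pos not_le)
      have "\<bar>W y\<bar> = \<bar>(-1) ^ (i - 1) * ((-1) ^ k * W y)\<bar>"
        by (simp add: abs_mult power_abs)
      then show "\<bar>W y\<bar> = (-1) ^ (i - 1) * ((-1) ^ k * (of_bool (k < i) - poly S y))"
        using s3 ind by (simp add: W_def)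
    qed
  qed
  have "((\<lambda>y. \<bar>W y\<bar>) has_integral (\<Sum>k<N. c k)) {z N..z 0}"
    using has_integral_consecutive[of N z "\<lambda>y. \<bar>W y\<bar>" c] piece mono by (auto simp: less_imp_le)
  moreover have "(\<Sum>k<N. c k) = tan (\<delta> / 2) * sin (real i * \<delta>)"
  proof -
    have "(\<Sum>k<N. c k) = (-1) ^ (i - 1) * ((\<Sum>k<N. (-1) ^ k * (of_bool (k < i) * (z k - z (Suc k))))
        - (\<Sum>k<N. (-1) ^ k * (poly Q (z k) - poly Q (z (Suc k)))))"
      unfolding c_def sum_distrib_left[symmetric] right_diff_distrib sum_subtractf ..
    \<comment> \<open>The antiderivative \<open>Q\<close> has degree at most
      \<open>m + 1 < N\<close>, just within reach of the Chebyshev sum.\<close>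
    also have "(\<Sum>k<N. (-1) ^ k * (poly Q (z k) - poly Q (z (Suc k)))) = 0"
      using alternating_chebyshev_sum[of Q N] Q degS by (simp add: z \<delta>_def N_def)
    also have "(\<Sum>k<N. (-1) ^ k * (of_bool (k < i) * (z k - z (Suc k)))) = (\<Sum>k<i. (-1) ^ k * (z k - z (Suc k)))"
      using i by (intro sum.mono_neutral_cong_right) (auto simp: N_def)
    also have "\<dots> = - ((-1) ^ i * tan (\<delta> / 2) * sin (real i * \<delta>))"
    proof -
      have "cos (\<delta> / 2) > 0"
        using N\<delta> mult_right_mono[of 2 "real N" \<delta>] by (intro cos_gt_zero_pi) (auto simp: N_def)
      then show ?thesis
        using alternating_cos_sum[of \<delta> i] unfolding z tan_def by (simp add: field_simps)
    qed
    also have "(-1) ^ (i - 1) * (- ((-1) ^ i * tan (\<delta> / 2) * sin (real i * \<delta>)) - 0) = tan (\<delta> / 2) * sin (real i * \<delta>)"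
    proof -
      obtain l where l: "i = Suc l" using i by (cases i) auto
      have "(-1::real) ^ l * (-1) ^ l = 1" by (simp flip: power_mult_distrib)
      then have "(-1) ^ l * (- ((-1) ^ Suc l * u * v) - 0) = u * v" for u v :: real
        by (cases "even l") auto
      from this[of "tan (\<delta> / 2)" "sin (real i * \<delta>)"] show ?thesis
        unfolding l diff_Suc_1 .
    qed
    finally show ?thesis .
  qed
  ultimately have "((\<lambda>y. \<bar>indicator {z i<..} y - poly S y\<bar>) has_integral tan (\<delta> / 2) * sin (real i * \<delta>)) {-1..1}"
    by (simp add: W_def z0)
  then show ?thesis
    using degS unfolding \<delta>_def N_def by (intro exI[of _ S] conjI)
qed

section \<open>Kernels orthogonal to polynomials\<close>

text \<open>Since \<open>pi = 2 * (m + 2) * x\<close>, the claim amounts to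
  \<open>tan x \<le> x * (m + 3) / (m + 1)\<close>. By \<open>sin x \<le> x\<close> and
  \<open>cos x \<ge> 1 - x^2 / 2\<close> it suffices that \<open>(m + 3) * x^2 \<le> 4\<close>,
  which follows from \<open>x \<le> 2 / (m + 2)\<close>, that is, from
  \<open>pi < 4\<close>.\<close>

lemma tan_plus_le:
  fixes m :: nat
  defines "x \<equiv> pi / real (m + 2) / 2"
  shows "tan x + x \<le> pi / real (m + 1)"
proof -
  have x0: "0 < x" by (simp add: x_def)
  have x2: "x \<le> 2 / real (m + 2)"
    using divide_right_mono[of "pi / 2" 2 "real (m + 2)"] pi_less_4 by (simp add: x_def mult.commute)
  then have x1: "x \<le> 1"
    by (rule order_trans) (simp add: divide_simps)
  have s: "sin x \<le> x" using x0 by (intro sin_x_le_x) auto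
  have "(sin (x / 2))\<^sup>2 \<le> (x / 2)\<^sup>2"
    using x0 x1 pi_gt3 by (intro power_mono sin_x_le_x sin_ge_zero) auto
  then have c: "1 - x\<^sup>2 / 2 \<le> cos x"
    using cos_double_sin[of "x / 2"] by (simp add: power_divide)
  have x21: "x\<^sup>2 \<le> 1" using x0 x1 by (simp add: power_le_one)
  have "x\<^sup>2 \<le> (2 / real (m + 2))\<^sup>2" using x0 x2 by (intro power_mono) auto
  then have "real (m + 3) * x\<^sup>2 \<le> real (m + 3) * (2 / real (m + 2))\<^sup>2"
    by (intro mult_left_mono) auto
  also have "\<dots> \<le> 4"
    by (simp add: power2_eq_square divide_simps) (simp add: algebra_simps)
  finally have "real (m + 1) \<le> real (m + 3) * (1 - x\<^sup>2 / 2)"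
    by (simp add: algebra_simps)
  also have "\<dots> \<le> real (m + 3) * cos x"
    using c by (intro mult_left_mono) auto
  finally have *: "real (m + 1) \<le> real (m + 3) * cos x" .
  have "cos x > 0" using c x21 by linarith
  have "sin x * real (m + 1) \<le> x * (real (m + 3) * cos x)"
    using * s x0 by (intro mult_mono) auto
  then have "tan x \<le> x * real (m + 3) / real (m + 1)"
    using \<open>cos x > 0\<close> unfolding tan_def by (simp add: divide_simps mult_ac)
  then have "tan x + x \<le> x * real (m + 3) / real (m + 1) + x" by simp
  also have "\<dots> = x * (2 * real (m + 2)) / real (m + 1)"
    by (simp add: field_simps)
  also have "x * (2 * real (m + 2)) = pi" by (simp add: x_def field_simps)
  finally show ?thesis .
qed

lemma abs_cos_diff_le: "\<bar>cos a - cos b\<bar> \<le> \<bar>a - b\<bar>" for a b :: real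
proof -
  have "\<bar>cos a - cos b\<bar> = 2 * \<bar>sin ((a + b) / 2)\<bar> * \<bar>sin ((b - a) / 2)\<bar>"
    by (simp add: cos_diff_cos abs_mult)
  also have "\<dots> \<le> 2 * 1 * \<bar>(b - a) / 2\<bar>"
    using abs_sin_x_le_abs_x[of "(b - a) / 2"] by (intro mult_mono mult_left_mono) auto
  finally show ?thesis by simp
qed

lemma norm_integral_le:
  fixes f :: "real \<Rightarrow> real"
  assumes "f integrable_on {a..b}" "a \<le> b" "\<And>x. x \<in> {a..b} \<Longrightarrow> norm (f x) \<le> B"
  shows "norm (integral {a..b} f) \<le> B * (b - a)"
  using integral_norm_bound_integral[of f "{a..b}" "\<lambda>_. B"] assms
  by (simp add: mult.commute integrable_const_ivl)

text \<open>Orthogonality allows subtracting the approximant \<open>S\<close> from the step, leaving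
  \<open>B\<close> times an explicit \<open>L^1\<close> norm. At the extreme angles the tail
  integral is zero: the interval is a point or all of \<open>{-1..1}\<close>.\<close>

lemma tail_integral_bound_chebyshev:
  fixes h :: "real \<Rightarrow> real" and m i :: nat
  assumes h: "h integrable_on {-1..1}" and B: "\<And>y. y \<in> {-1..1} \<Longrightarrow> \<bar>h y\<bar> \<le> B"
    and orth: "\<And>p. degree p \<le> m \<Longrightarrow> integral {-1..1} (\<lambda>y. h y * poly p y) = 0"
    and i: "i \<le> m + 2"
  shows "\<bar>integral {cos (real i * (pi / real (m + 2)))..1} h\<bar> \<le> B * tan (pi / real (m + 2) / 2)"
proof -
  define z where "z = cos (real i * (pi / real (m + 2)))"
  have B0: "0 \<le> B" using B[of 0] by auto
  have "pi / real (m + 2) \<le> pi / 2" by (intro divide_left_mono) auto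
  moreover have "u / 2 < pi / 2" if "u \<le> pi / 2" for u using that pi_gt_zero by linarith
  ultimately have "pi / real (m + 2) / 2 < pi / 2" by blast
  moreover have "0 < pi / real (m + 2) / 2" by simp
  ultimately have tan0: "0 \<le> tan (pi / real (m + 2) / 2)"
    by (intro less_imp_le tan_gt_zero)
  have zero: "integral {-1..1} h = 0" using orth[of 1] by simp
  consider "i = 0" | "i = m + 2" | "1 \<le> i" "i \<le> m + 1" using i by linarith
  then have "\<bar>integral {z..1} h\<bar> \<le> B * tan (pi / real (m + 2) / 2)"
  proof cases
    case 1
    then show ?thesis using B0 tan0 by (simp add: z_def)
  next
    case 2
    then show ?thesis using B0 tan0 zero by (simp add: z_def)
  next
    case 3
    obtain S where S: "degree S \<le> m" "((\<lambda>y. \<bar>indicator {z<..} y - poly S y\<bar>) has_integral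
       tan (pi / real (m + 2) / 2) * sin (real i * (pi / real (m + 2)))) {-1..1}"
      using step_approximation[OF 3] unfolding z_def by blast
    have bh: "bounded (h ` {-1..1})" using B by (intro boundedI[of _ B]) auto
    have iS: "(\<lambda>y. h y * poly S y) integrable_on {-1..1}"
      by (intro integrable_bounded_mult h bh bounded_poly_Icc integrable_continuous_interval[of _ _ "poly S"] continuous_intros)
    have z1: "-1 \<le> z" "z \<le> 1" by (auto simp: z_def)
    have "(h has_integral integral {z..1} h) {z..1}"
      using integrable_subinterval_real[OF h] z1 by (intro integrable_integral) auto
    then have "((\<lambda>y. if y \<in> {z..1} then h y else 0) has_integral integral {z..1} h) {-1..1}"
      using z1 by (subst has_integral_restrict) auto
    \<comment> \<open>Open and closed half-lines differ only at the point \<open>z\<close>.\<close>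
    then have ind: "((\<lambda>y. h y * indicator {z<..} y) has_integral integral {z..1} h) {-1..1}"
      by (rule has_integral_spike_finite[of "{z}", rotated 2]) (auto simp: indicator_def)
    have "((\<lambda>y. h y * indicator {z<..} y - h y * poly S y) has_integral (integral {z..1} h - 0)) {-1..1}"
      using integrable_integral[OF iS] orth[OF S(1)] by (intro has_integral_diff ind) simp
    then have W: "((\<lambda>y. h y * (indicator {z<..} y - poly S y)) has_integral integral {z..1} h) {-1..1}"
      by (simp add: right_diff_distrib)
    have BW: "((\<lambda>y. B * \<bar>indicator {z<..} y - poly S y\<bar>) has_integral
        B * (tan (pi / real (m + 2) / 2) * sin (real i * (pi / real (m + 2))))) {-1..1}"
      by (intro has_integral_mult_right S(2))
    have "norm (integral {-1..1} (\<lambda>y. h y * (indicator {z<..} y - poly S y)))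
       \<le> integral {-1..1} (\<lambda>y. B * \<bar>indicator {z<..} y - poly S y\<bar>)"
      using W BW B by (intro integral_norm_bound_integral) (auto simp: abs_mult intro!: mult_right_mono)
    then have "\<bar>integral {z..1} h\<bar> \<le> B * (tan (pi / real (m + 2) / 2) * sin (real i * (pi / real (m + 2))))"
      unfolding integral_unique[OF W] integral_unique[OF BW] by simp
    also have "\<dots> \<le> B * (tan (pi / real (m + 2) / 2) * 1)"
      using B0 tan0 by (intro mult_left_mono) auto
    finally show ?thesis by simp
  qed
  then show ?thesis by (simp add: z_def)
qed

text \<open>Replace \<open>t\<close> by the cosine \<open>z\<close> of the grid angle nearest to
  \<open>arccos t\<close>. The angles differ by at most \<open>\<delta> / 2\<close> and cosine is
  1-Lipschitz, so this costs \<open>B * \<delta> / 2\<close>; together with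
  \<open>B * tan (\<delta> / 2)\<close> at \<open>z\<close> it stays below the bound by
  \<open>tan_plus_le\<close>.\<close>

lemma tail_integral_bound:
  fixes h :: "real \<Rightarrow> real" and m :: nat
  assumes h: "h integrable_on {-1..1}" and B: "\<And>y. y \<in> {-1..1} \<Longrightarrow> \<bar>h y\<bar> \<le> B"
    and orth: "\<And>p. degree p \<le> m \<Longrightarrow> integral {-1..1} (\<lambda>y. h y * poly p y) = 0"
    and t: "t \<in> {-1..1}"
  shows "\<bar>integral {t..1} h\<bar> \<le> B * (pi / real (m + 1))"
proof -
  define \<theta> \<delta> i where "\<theta> = arccos t" and "\<delta> = pi / real (m + 2)" and "i = nat (round (\<theta> / \<delta>))"
  have \<delta>: "\<delta> > 0" "real (m + 2) * \<delta> = pi" by (auto simp: \<delta>_def)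
  have \<theta>: "0 \<le> \<theta>" "\<theta> \<le> pi" "t = cos \<theta>" using t by (auto simp: \<theta>_def arccos_lbound arccos_ubound)
  have "\<theta> / \<delta> \<le> real (m + 2)" using \<theta> \<delta> by (simp add: divide_le_eq)
  then have "round (\<theta> / \<delta>) \<le> round (real (m + 2))" by (rule round_mono)
  then have i: "i \<le> m + 2" unfolding i_def round_of_nat by linarith
  have "0 \<le> round (\<theta> / \<delta>)" using \<theta> \<delta> round_mono[of 0 "\<theta> / \<delta>"] by simp
  then have ri: "real i = of_int (round (\<theta> / \<delta>))" by (simp add: i_def)
  have "\<bar>real i - \<theta> / \<delta>\<bar> \<le> 1 / 2" unfolding ri by (rule of_int_round_abs_le)
  then have "\<bar>real i - \<theta> / \<delta>\<bar> * \<delta> \<le> 1 / 2 * \<delta>" using \<delta> by (intro mult_right_mono) auto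
  moreover have "\<bar>real i - \<theta> / \<delta>\<bar> * \<delta> = \<bar>(real i - \<theta> / \<delta>) * \<delta>\<bar>" using \<delta> by (simp add: abs_mult)
  moreover have "(real i - \<theta> / \<delta>) * \<delta> = real i * \<delta> - \<theta>" using \<delta> by (simp add: field_simps)
  ultimately have d: "\<bar>real i * \<delta> - \<theta>\<bar> \<le> \<delta> / 2" by simp
  define z where "z = cos (real i * \<delta>)"
  have z: "-1 \<le> z" "z \<le> 1" by (auto simp: z_def)
  have B0: "0 \<le> B" using B[of 0] by auto
  have zt: "\<bar>z - t\<bar> \<le> \<delta> / 2"
    using abs_cos_diff_le[of "real i * \<delta>" \<theta>] d by (simp add: z_def \<theta>)
  have piece: "\<bar>integral {p..1} h - integral {q..1} h\<bar> \<le> B * (q - p)" if "-1 \<le> p" "p \<le> q" "q \<le> 1" for p q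
  proof -
    have "integral {p..q} h + integral {q..1} h = integral {p..1} h"
      using that integrable_subinterval_real[OF h, of p 1] by (intro Henstock_Kurzweil_Integration.integral_combine) auto
    moreover have "norm (integral {p..q} h) \<le> B * (q - p)"
      using that integrable_subinterval_real[OF h] B by (intro norm_integral_le) auto
    ultimately show ?thesis by simp
  qed
  have "\<bar>integral {t..1} h - integral {z..1} h\<bar> \<le> B * \<bar>z - t\<bar>"
    using piece[of t z] piece[of z t] z t by (cases "t \<le> z") (auto simp: abs_minus_commute)
  also have "\<dots> \<le> B * (\<delta> / 2)" using zt B0 by (intro mult_left_mono) auto
  finally have 1: "\<bar>integral {t..1} h - integral {z..1} h\<bar> \<le> B * (\<delta> / 2)" .
  have 2: "\<bar>integral {z..1} h\<bar> \<le> B * tan (\<delta> / 2)"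
    unfolding z_def \<delta>_def using h B orth i by (rule tail_integral_bound_chebyshev)
  have "B * (tan (\<delta> / 2) + \<delta> / 2) \<le> B * (pi / real (m + 1))"
    unfolding \<delta>_def using B0 by (intro mult_left_mono tan_plus_le)
  then show ?thesis using 1 2 unfolding distrib_left by linarith
qed

text \<open>No regularity beyond boundedness is needed: the difference of the two sides over \<open>[a,T]\<close>,
  corrected by the boundary term, changes by \<open>O((T - S)\<^sup>2)\<close> between \<open>S\<close> and \<open>T\<close>.\<close>

lemma integral_by_parts_bounded:
  fixes k g :: "real \<Rightarrow> real"
  assumes ab: "a \<le> b" and k: "k integrable_on {a..b}" "bounded (k ` {a..b})"
    and g: "g integrable_on {a..b}" "bounded (g ` {a..b})"
  shows "integral {a..b} (\<lambda>t. k t * integral {a..t} g) = integral {a..b} (\<lambda>t. integral {t..b} k * g t)"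
proof -
  define G where "G t = integral {a..t} g" for t
  define K where "K t = integral {t..b} k" for t
  have cG: "continuous_on {a..b} G" unfolding G_def using g by (intro indefinite_integral_continuous_1)
  have cK: "continuous_on {a..b} K" unfolding K_def using k by (intro indefinite_integral_continuous_1')
  have bd: "bounded (f ` {a..b})" "f integrable_on {a..b}" if "continuous_on {a..b} f" for f :: "real \<Rightarrow> real"
    using that by (auto intro: compact_imp_bounded compact_continuous_image integrable_continuous_interval)
  have i1: "(\<lambda>t. k t * G t) integrable_on {a..b}" and i2: "(\<lambda>t. K t * g t) integrable_on {a..b}"
    using k g bd[OF cG] bd[OF cK] by (auto intro: integrable_bounded_mult)
  define F where "F t = k t * G t - K t * g t" for t
  have iF: "F integrable_on {a..b}" unfolding F_def by (intro integrable_diff i1 i2)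
  obtain C1 where C1: "\<forall>y\<in>k ` {a..b}. norm y \<le> C1" using k(2) unfolding bounded_iff by blast
  obtain C2 where C2: "\<forall>y\<in>g ` {a..b}. norm y \<le> C2" using g(2) unfolding bounded_iff by blast
  define C where "C = max C1 C2"
  have C: "\<bar>k t\<bar> \<le> C" "\<bar>g t\<bar> \<le> C" if "t \<in> {a..b}" for t
    using C1 C2 that by (force simp: C_def)+
  have C0: "C \<ge> 0" using C(1)[of a] ab by force
  define \<Phi> where "\<Phi> t = integral {a..t} F + K t * G t" for t
  have est: "\<bar>\<Phi> T - \<Phi> S\<bar> \<le> (2 * C\<^sup>2) * (T - S)\<^sup>2" if ST: "a \<le> S" "S \<le> T" "T \<le> b" for S T
  proof -
    have sub: "f integrable_on {p..q}" if "f integrable_on {a..b}" "a \<le> p" "q \<le> b" for f :: "real \<Rightarrow> real" and p q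
      using integrable_subinterval_real[OF that(1)] that by auto
    have dG: "integral {p..q} g = G q - G p" if "a \<le> p" "p \<le> q" "q \<le> b" for p q
      using Henstock_Kurzweil_Integration.integral_combine[of a p q g] sub[OF g(1)] that by (simp add: G_def)
    have dK: "integral {p..q} k = K p - K q" if "a \<le> p" "p \<le> q" "q \<le> b" for p q
      using Henstock_Kurzweil_Integration.integral_combine[of p q b k] sub[OF k(1)] that by (simp add: K_def)
    have dF: "integral {S..T} F = integral {a..T} F - integral {a..S} F"
      using Henstock_Kurzweil_Integration.integral_combine[of a S T F] sub[OF iF] ST by simp
    \<comment> \<open>Chosen so that its integral over \<open>{S..T}\<close> is the increment of
      \<open>\<Phi>\<close>. Both \<open>G u - G T\<close> and \<open>K u - K S\<close> are at most
      \<open>C * (T - S)\<close> in size, and the length of the interval supplies the second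
      factor.\<close>
    define h where "h u = k u * (G u - G T) - g u * (K u - K S)" for u
    have "((\<lambda>u. F u - k u * G T + K S * g u) has_integral
        integral {S..T} F - integral {S..T} k * G T + K S * integral {S..T} g) {S..T}"
      using sub[OF iF ST(1,3)] sub[OF k(1) ST(1,3)] sub[OF g(1) ST(1,3)]
      by (intro has_integral_add has_integral_diff has_integral_mult_left has_integral_mult_right
          integrable_integral)
    moreover have "(\<lambda>u. F u - k u * G T + K S * g u) = h"
      by (auto simp: h_def F_def algebra_simps)
    moreover have "integral {S..T} F - integral {S..T} k * G T + K S * integral {S..T} g = \<Phi> T - \<Phi> S"
      unfolding dF dG[OF ST] dK[OF ST] by (simp add: \<Phi>_def algebra_simps)
    ultimately have h: "(h has_integral (\<Phi> T - \<Phi> S)) {S..T}" by simp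
    have lip: "\<bar>integral {p..q} f\<bar> \<le> C * (T - S)"
      if "f integrable_on {a..b}" "\<And>t. t \<in> {a..b} \<Longrightarrow> \<bar>f t\<bar> \<le> C" "S \<le> p" "p \<le> q" "q \<le> T" for f p q
    proof -
      have "norm (integral {p..q} f) \<le> C * (q - p)"
        using that ST sub[of f p q] by (intro norm_integral_le) auto
      also have "\<dots> \<le> C * (T - S)" using that C0 by (intro mult_left_mono) auto
      finally show ?thesis by simp
    qed
    have "norm (h u) \<le> 2 * C * (C * (T - S))" if u: "u \<in> {S..T}" for u
    proof -
      have "\<bar>G u - G T\<bar> \<le> C * (T - S)"
        using lip[OF g(1) C(2), of u T] dG[of u T] u ST by auto
      moreover have "\<bar>K u - K S\<bar> \<le> C * (T - S)"
        using lip[OF k(1) C(1), of S u] dK[of S u] u ST by auto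
      ultimately have "\<bar>k u * (G u - G T)\<bar> \<le> C * (C * (T - S))" "\<bar>g u * (K u - K S)\<bar> \<le> C * (C * (T - S))"
        unfolding abs_mult using C[of u] C0 u ST by (auto intro!: mult_mono)
      then show ?thesis unfolding h_def by simp
    qed
    then have "norm (integral {S..T} h) \<le> 2 * C * (C * (T - S)) * (T - S)"
      using h ST by (intro norm_integral_le) auto
    then show ?thesis unfolding integral_unique[OF h] by (simp add: power2_eq_square mult_ac)
  qed
  have est': "\<bar>\<Phi> y - \<Phi> x\<bar> \<le> (2 * C\<^sup>2) * (y - x)\<^sup>2" if "x \<in> {a..b}" "y \<in> {a..b}" for x y
    using est[of x y] est[of y x] that by (cases "x \<le> y") (auto simp: abs_minus_commute power2_commute)
  have "(\<Phi> has_field_derivative 0) (at x within {a..b})" if x: "x \<in> {a..b}" for x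
    unfolding has_field_derivative_iff
  proof (rule Lim_null_comparison)
    show "\<forall>\<^sub>F y in at x within {a..b}. norm ((\<Phi> y - \<Phi> x) / (y - x)) \<le> (2 * C\<^sup>2) * \<bar>y - x\<bar>"
      unfolding eventually_at_filter
    proof (intro always_eventually allI impI)
      fix y assume "y \<noteq> x" "y \<in> {a..b}"
      then show "norm ((\<Phi> y - \<Phi> x) / (y - x)) \<le> (2 * C\<^sup>2) * \<bar>y - x\<bar>"
        using est'[OF x] by (simp add: divide_le_eq power2_eq_square abs_mult_self_eq mult.assoc)
    qed
    have "((\<lambda>y. 2 * C\<^sup>2 * \<bar>y - x\<bar>) \<longlongrightarrow> 2 * C\<^sup>2 * \<bar>x - x\<bar>) (at x within {a..b})"
      by (intro tendsto_intros)
    then show "((\<lambda>y. 2 * C\<^sup>2 * \<bar>y - x\<bar>) \<longlongrightarrow> 0) (at x within {a..b})" by simp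
  qed
  then obtain c where c: "\<And>x. x \<in> {a..b} \<Longrightarrow> \<Phi> x = c"
    using has_field_derivative_zero_constant[of "{a..b}" \<Phi>] by auto
  \<comment> \<open>The boundary terms vanish at both ends because \<open>K b = 0\<close> and
    \<open>G a = 0\<close>.\<close>
  have "\<Phi> b = \<Phi> a" using c[of a] c[of b] ab by simp
  then have "integral {a..b} F = 0" by (simp add: \<Phi>_def K_def G_def)
  then have "integral {a..b} (\<lambda>t. k t * G t) - integral {a..b} (\<lambda>t. K t * g t) = 0"
    unfolding F_def using i1 i2 by (simp add: integral_diff)
  then show ?thesis by (simp add: G_def K_def)
qed

section \<open>Total variation and integration against functions of bounded variation\<close>

lemma variation_sums_mono: "s \<le> t \<Longrightarrow> variation_sums a s g \<subseteq> variation_sums a t g"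
  by (force simp: variation_sums_def)

lemma zero_in_variation_sums: "a \<le> s \<Longrightarrow> 0 \<in> variation_sums a s g"
  unfolding variation_sums_def by (intro CollectI exI[of _ 0] exI[of _ "\<lambda>_. a"]) (auto simp: mono_on_def)

text \<open>Any partition of \<open>{a..s}\<close> extends by \<open>s\<close> and \<open>t\<close>.
  The inequality makes the variation function plus or minus \<open>g\<close> nondecreasing, which is
  the Jordan decomposition.\<close>

lemma total_variation_increment:
  assumes bv: "bounded_variation_on a b g" and st: "a \<le> s" "s \<le> t" "t \<le> b"
  shows "total_variation a s g + \<bar>g t - g s\<bar> \<le> total_variation a t g"
proof -
  have bdd: "bdd_above (variation_sums a t g)"
    using bv variation_sums_mono[of t b a g] st unfolding bounded_variation_on_def by (auto intro: bdd_above_mono)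
  have "w \<le> total_variation a t g - \<bar>g t - g s\<bar>" if w: "w \<in> variation_sums a s g" for w
  proof -
    from w obtain m \<tau> where \<tau>: "w = (\<Sum>i<m. \<bar>g (\<tau> (Suc i)) - g (\<tau> i)\<bar>)"
      "mono_on {..m::nat} \<tau>" "\<tau> ` {..m} \<subseteq> {a..s}"
      unfolding variation_sums_def by blast
    \<comment> \<open>The new points occupy the indices \<open>m + 1\<close> and
      \<open>m + 2\<close>; the summand from \<open>\<tau> m\<close> to \<open>s\<close> is
      nonnegative and is dropped.\<close>
    define \<sigma> where "\<sigma> i = (if i \<le> m then \<tau> i else if i = Suc m then s else t)" for i
    have rng: "\<tau> i \<in> {a..s}" if "i \<le> m" for i using \<tau>(3) that by auto
    have "mono_on {..Suc (Suc m)} \<sigma>"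
    proof (rule mono_onI)
      fix p q assume pq: "p \<in> {..Suc (Suc m)}" "q \<in> {..Suc (Suc m)}" "p \<le> q"
      then show "\<sigma> p \<le> \<sigma> q"
        using mono_onD[OF \<tau>(2), of p q] rng[of p] st by (auto simp: \<sigma>_def)
    qed
    moreover have "\<sigma> ` {..Suc (Suc m)} \<subseteq> {a..t}"
      using rng st by (fastforce simp: \<sigma>_def)
    ultimately have "(\<Sum>i<Suc (Suc m). \<bar>g (\<sigma> (Suc i)) - g (\<sigma> i)\<bar>) \<in> variation_sums a t g"
      unfolding variation_sums_def by blast
    then have "(\<Sum>i<Suc (Suc m). \<bar>g (\<sigma> (Suc i)) - g (\<sigma> i)\<bar>) \<le> total_variation a t g"
      unfolding total_variation_def using bdd by (rule cSup_upper)
    moreover have "(\<Sum>i<m. \<bar>g (\<sigma> (Suc i)) - g (\<sigma> i)\<bar>) = w"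
      unfolding \<tau>(1) by (intro sum.cong) (auto simp: \<sigma>_def)
    moreover have "\<sigma> (Suc (Suc m)) = t" "\<sigma> (Suc m) = s" by (auto simp: \<sigma>_def)
    ultimately show ?thesis by simp
  qed
  then have "total_variation a s g \<le> total_variation a t g - \<bar>g t - g s\<bar>"
    unfolding total_variation_def[of a s] using zero_in_variation_sums[OF st(1), of g] by (intro cSup_least) auto
  then show ?thesis by simp
qed

lemma total_variation_nonneg:
  assumes "bounded_variation_on a b g" "a \<le> s" "s \<le> b"
  shows "0 \<le> total_variation a s g"
  unfolding total_variation_def
  using assms zero_in_variation_sums variation_sums_mono[of s b a g]
  by (intro cSup_upper) (auto simp: bounded_variation_on_def intro: bdd_above_mono)

lemma bounded_variation_bounded:
  assumes "bounded_variation_on a b g"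
  shows "bounded (g ` {a..b})"
proof -
  have "\<bar>g t\<bar> \<le> \<bar>g a\<bar> + total_variation a b g" if "t \<in> {a..b}" for t
    using total_variation_increment[OF assms, of a t] total_variation_increment[OF assms, of t b]
      total_variation_nonneg[OF assms, of a] that by auto
  then show ?thesis
    unfolding bounded_iff by (intro exI[of _ "\<bar>g a\<bar> + total_variation a b g"]) auto
qed

text \<open>For monotone \<open>f\<close> the second mean value theorem and the zero integral of
  \<open>k\<close> give \<open>(f b - f a)\<close> times one tail integral. The halved parts
  \<open>(v + g) / 2\<close> and \<open>(v - g) / 2\<close> have increments adding up to
  \<open>v b - v a\<close>, so the constant is exactly \<open>M\<close>.\<close>

lemma bounded_variation_integral_bound:
  fixes g k :: "real \<Rightarrow> real"
  assumes bv: "bounded_variation_on a b g" and ab: "a \<le> b" and k: "k integrable_on {a..b}"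
    and M: "\<And>t. t \<in> {a..b} \<Longrightarrow> \<bar>integral {t..b} k\<bar> \<le> M" and zero: "integral {a..b} k = 0"
  shows "\<bar>integral {a..b} (\<lambda>t. k t * g t)\<bar> \<le> M * total_variation a b g"
proof -
  define v where "v t = total_variation a t g" for t
  have inc: "v s + \<bar>g t - g s\<bar> \<le> v t" if "a \<le> s" "s \<le> t" "t \<le> b" for s t
    using total_variation_increment[OF bv that] by (simp add: v_def)
  have bound: "\<exists>c. \<bar>c\<bar> \<le> M * (f b - f a) \<and> ((\<lambda>t. f t * k t) has_integral c) {a..b}"
    if f: "\<And>x y. a \<le> x \<Longrightarrow> x \<le> y \<Longrightarrow> y \<le> b \<Longrightarrow> f x \<le> f y" for f :: "real \<Rightarrow> real"
  proof -
    obtain c where c: "c \<in> {a..b}"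
      "((\<lambda>x. f x * k x) has_integral (f a * integral {a..c} k + f b * integral {c..b} k)) {a..b}"
      using second_mean_value_theorem_full[where g = f, OF k ab f] by blast
    have "integral {a..c} k + integral {c..b} k = 0"
      using c k zero Henstock_Kurzweil_Integration.integral_combine[of a c b k] by auto
    then have "integral {a..c} k = - integral {c..b} k" by linarith
    then have "f a * integral {a..c} k + f b * integral {c..b} k = (f b - f a) * integral {c..b} k"
      by (simp add: algebra_simps)
    moreover have "\<bar>(f b - f a) * integral {c..b} k\<bar> \<le> M * (f b - f a)"
      using f[of a b] ab M[OF c(1)] by (simp add: abs_mult mult.commute[of M] mult_left_mono)
    ultimately show ?thesis using c(2) by auto
  qed
  have incr: "(v x + g x) / 2 \<le> (v y + g y) / 2" "(v x - g x) / 2 \<le> (v y - g y) / 2"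
    if "a \<le> x" "x \<le> y" "y \<le> b" for x y
    using inc[OF that] by (auto simp: abs_if split: if_splits)
  obtain c1 where c1: "\<bar>c1\<bar> \<le> M * ((v b + g b) / 2 - (v a + g a) / 2)"
      "((\<lambda>t. (v t + g t) / 2 * k t) has_integral c1) {a..b}"
    using bound[of "\<lambda>t. (v t + g t) / 2", OF incr(1)] by blast
  obtain c2 where c2: "\<bar>c2\<bar> \<le> M * ((v b - g b) / 2 - (v a - g a) / 2)"
      "((\<lambda>t. (v t - g t) / 2 * k t) has_integral c2) {a..b}"
    using bound[of "\<lambda>t. (v t - g t) / 2", OF incr(2)] by blast
  have "((\<lambda>t. (v t + g t) / 2 * k t - (v t - g t) / 2 * k t) has_integral (c1 - c2)) {a..b}"
    by (intro has_integral_diff c1 c2)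
  moreover have "(\<lambda>t. (v t + g t) / 2 * k t - (v t - g t) / 2 * k t) = (\<lambda>t. k t * g t)"
    by (auto simp: field_simps)
  ultimately have "integral {a..b} (\<lambda>t. k t * g t) = c1 - c2" by (simp add: integral_unique)
  then have "\<bar>integral {a..b} (\<lambda>t. k t * g t)\<bar> \<le> \<bar>c1\<bar> + \<bar>c2\<bar>" by simp
  also have "\<dots> \<le> M * ((v b + g b) / 2 - (v a + g a) / 2) + M * ((v b - g b) / 2 - (v a - g a) / 2)"
    using c1(1) c2(1) by simp
  also have "\<dots> = M * (v b - v a)" by (simp add: field_simps)
  also have "\<dots> \<le> M * v b"
  proof -
    have "0 \<le> M" using M[of a] ab by force
    moreover have "0 \<le> v a" unfolding v_def using total_variation_nonneg[OF bv] ab by simp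
    ultimately show ?thesis by (intro mult_left_mono) auto
  qed
  finally show ?thesis by (simp add: v_def)
qed

section \<open>Iterated kernels and the error bound\<close>

lemma integrable_poly_Icc: "poly p integrable_on {a..b::real}"
  by (rule integrable_continuous_interval) (intro continuous_on_poly continuous_on_id)

text \<open>Indices are shifted by one: \<open>iterated_tail k j\<close> is the Peano kernel of
  order \<open>j + 1\<close>.\<close>

primrec iterated_tail :: "(real \<Rightarrow> real) \<Rightarrow> nat \<Rightarrow> real \<Rightarrow> real" where
  "iterated_tail k 0 = k"
| "iterated_tail k (Suc j) = (\<lambda>t. integral {t..1} (iterated_tail k j))"

text \<open>The three claims need a joint induction, since the bound at \<open>j + 1\<close> uses
  orthogonality at \<open>j\<close>, up to degree \<open>d - j\<close>. At \<open>j = Suc d\<close>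
  the orthogonality claim is vacuous but the bound still holds.\<close>

lemma iterated_tail_properties:
  fixes k :: "real \<Rightarrow> real"
  assumes k: "k integrable_on {-1..1}" and B: "\<And>t. t \<in> {-1..1} \<Longrightarrow> \<bar>k t\<bar> \<le> B"
    and orth: "\<And>p. degree p \<le> d \<Longrightarrow> integral {-1..1} (\<lambda>t. k t * poly p t) = 0"
    and j: "j \<le> Suc d"
  shows "iterated_tail k j integrable_on {-1..1}"
    and "t \<in> {-1..1} \<Longrightarrow> \<bar>iterated_tail k j t\<bar> \<le> B * (\<Prod>i<j. pi / real (Suc d - i))"
    and "degree p + j \<le> d \<Longrightarrow> integral {-1..1} (\<lambda>t. iterated_tail k j t * poly p t) = 0"
proof -
  have "iterated_tail k j integrable_on {-1..1} \<and>
     (\<forall>t\<in>{-1..1}. \<bar>iterated_tail k j t\<bar> \<le> B * (\<Prod>i<j. pi / real (Suc d - i))) \<and>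
     (\<forall>p. degree p + j \<le> d \<longrightarrow> integral {-1..1} (\<lambda>t. iterated_tail k j t * poly p t) = 0)"
    using j
  proof (induction j)
    case 0
    then show ?case using k B orth by simp
  next
    case (Suc j)
    let ?h = "iterated_tail k j" and ?C = "B * (\<Prod>i<j. pi / real (Suc d - i))"
    have jd: "j \<le> d" using Suc.prems by simp
    have h: "?h integrable_on {-1..1}" and C: "\<And>t. t \<in> {-1..1} \<Longrightarrow> \<bar>?h t\<bar> \<le> ?C"
      and o: "\<And>p. degree p + j \<le> d \<Longrightarrow> integral {-1..1} (\<lambda>t. ?h t * poly p t) = 0"
      using Suc.IH jd by auto
    have bh: "bounded (?h ` {-1..1})" using C by (intro boundedI[of _ ?C]) auto
    have "continuous_on {-1..1} (iterated_tail k (Suc j))"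
      unfolding iterated_tail.simps by (intro indefinite_integral_continuous_1' h)
    moreover have "\<bar>iterated_tail k (Suc j) t\<bar> \<le> B * (\<Prod>i<Suc j. pi / real (Suc d - i))" if t: "t \<in> {-1..1}" for t
    proof -
      have "\<bar>integral {t..1} ?h\<bar> \<le> ?C * (pi / real (d - j + 1))"
        using jd by (intro tail_integral_bound h C o t) auto
      moreover have "d - j + 1 = Suc d - j" using jd by simp
      ultimately show ?thesis
        unfolding iterated_tail.simps prod.lessThan_Suc by (simp only: mult.assoc)
    qed
    moreover have "integral {-1..1} (\<lambda>t. iterated_tail k (Suc j) t * poly p t) = 0"
      if p: "degree p + Suc j \<le> d" for p
    proof -
      \<comment> \<open>Integration by parts moves the tail integral onto \<open>p\<close>. The
        antiderivative vanishing at \<open>-1\<close> has degree one higher, which the previous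
        kernel still annihilates.\<close>
      obtain Q where Q: "pderiv Q = p" "degree Q \<le> Suc (degree p)" using poly_antiderivative by blast
      have anti: "integral {-1..t} (poly p) = poly Q t - poly Q (-1)" if "t \<in> {-1..1}" for t
        using has_integral_poly_pderiv[of "-1" t Q] that by (simp add: Q integral_unique)
      have "integral {-1..1} (\<lambda>t. iterated_tail k (Suc j) t * poly p t)
          = integral {-1..1} (\<lambda>t. ?h t * integral {-1..t} (poly p))"
        unfolding iterated_tail.simps
        by (rule integral_by_parts_bounded[symmetric])
          (auto intro: h bh bounded_poly_Icc integrable_poly_Icc)
      also have "\<dots> = integral {-1..1} (\<lambda>t. ?h t * poly (Q - [:poly Q (-1):]) t)"
        by (intro integral_cong) (simp add: anti)
      also have "\<dots> = 0"
      proof (rule o)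
        have "degree (Q - [:poly Q (-1):]) \<le> degree Q" by (rule degree_diff_le) auto
        then show "degree (Q - [:poly Q (-1):]) + j \<le> d" using Q p by simp
      qed
      finally show ?thesis .
    qed
    ultimately show ?case by (auto intro: integrable_continuous_interval)
  qed
  then show "iterated_tail k j integrable_on {-1..1}"
    "t \<in> {-1..1} \<Longrightarrow> \<bar>iterated_tail k j t\<bar> \<le> B * (\<Prod>i<j. pi / real (Suc d - i))"
    "degree p + j \<le> d \<Longrightarrow> integral {-1..1} (\<lambda>t. iterated_tail k j t * poly p t) = 0"
    by auto
qed

text \<open>Each round replaces \<open>F j\<close> by its density \<open>F (Suc j)\<close>. The
  boundary term is \<open>F j (-1)\<close> times the integral of the current kernel, which is zero
  by orthogonality to constants.\<close>

lemma iterated_tail_by_parts: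
  fixes k :: "real \<Rightarrow> real" and F :: "nat \<Rightarrow> real \<Rightarrow> real"
  assumes k: "k integrable_on {-1..1}" and B: "\<And>t. t \<in> {-1..1} \<Longrightarrow> \<bar>k t\<bar> \<le> B"
    and orth: "\<And>p. degree p \<le> d \<Longrightarrow> integral {-1..1} (\<lambda>t. k t * poly p t) = 0"
    and j: "j \<le> d"
    and F: "\<And>i t. i < j \<Longrightarrow> t \<in> {-1..1} \<Longrightarrow> F i t = F i (-1) + integral {-1..t} (F (Suc i))"
    and Fint: "\<And>i. i \<le> j \<Longrightarrow> F i integrable_on {-1..1}"
    and Fbd: "\<And>i. i \<le> j \<Longrightarrow> bounded (F i ` {-1..1})"
  shows "integral {-1..1} (\<lambda>t. k t * F 0 t) = integral {-1..1} (\<lambda>t. iterated_tail k j t * F j t)"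
  using j F Fint Fbd
proof (induction j)
  case (Suc j)
  let ?h = "iterated_tail k j" and ?C = "B * (\<Prod>i<j. pi / real (Suc d - i))"
  have j: "j \<le> Suc d" using Suc.prems(1) by simp
  note props = iterated_tail_properties[of k B d j, OF k B _ j]
  have h: "?h integrable_on {-1..1}" by (rule props(1)) (auto intro: orth)
  have "\<bar>?h t\<bar> \<le> ?C" if "t \<in> {-1..1}" for t
    using that by (intro props(2)) (auto intro: orth)
  then have bh: "bounded (?h ` {-1..1})" by (intro boundedI[of _ ?C]) auto
  have "integral {-1..1} (\<lambda>t. ?h t * poly 1 t) = 0"
    using Suc.prems(1) by (intro props(3)) (auto intro: orth)
  then have zero: "integral {-1..1} ?h = 0" by simp
  have bG: "continuous_on {-1..1} (\<lambda>t. integral {-1..t} (F (Suc j)))"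
    by (intro indefinite_integral_continuous_1 Suc.prems(3)) simp
  have "integral {-1..1} (\<lambda>t. k t * F 0 t) = integral {-1..1} (\<lambda>t. ?h t * F j t)"
  proof (rule Suc.IH)
    show "F i t = F i (-1) + integral {-1..t} (F (Suc i))" if "i < j" "t \<in> {-1..1}" for i t
      by (rule Suc.prems(2)) (use that in auto)
  qed (use Suc.prems(1,3,4) in auto)
  also have "\<dots> = integral {-1..1} (\<lambda>t. F j (-1) * ?h t + ?h t * integral {-1..t} (F (Suc j)))"
  proof (rule integral_cong)
    fix t :: real assume "t \<in> {-1..1}"
    then show "?h t * F j t = F j (-1) * ?h t + ?h t * integral {-1..t} (F (Suc j))"
      using Suc.prems(2)[of j t] by (simp only: lessI True_implies_equals) (simp add: algebra_simps)
  qed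
  also have "\<dots> = F j (-1) * integral {-1..1} ?h + integral {-1..1} (\<lambda>t. ?h t * integral {-1..t} (F (Suc j)))"
  proof -
    have "(\<lambda>t. ?h t * integral {-1..t} (F (Suc j))) integrable_on {-1..1}"
      using bG by (intro integrable_bounded_mult h bh)
        (auto intro: integrable_continuous_interval compact_imp_bounded compact_continuous_image)
    then show ?thesis using h by (simp add: integral_add integrable_on_mult_right)
  qed
  also have "integral {-1..1} (\<lambda>t. ?h t * integral {-1..t} (F (Suc j)))
      = integral {-1..1} (\<lambda>t. iterated_tail k (Suc j) t * F (Suc j) t)"
    unfolding iterated_tail.simps using Suc.prems(3,4) by (intro integral_by_parts_bounded h bh) auto
  finally show ?case using zero by simp
qed simp

text \<open>The Peano representation: \<open>F a\<close> is a constant plus the integral of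
  \<open>f\<close> against \<open>indicator {t..} a\<close>, and the divided difference annihilates
  the constant.\<close>

lemma divdiff_step_kernel:
  assumes A: "finite A" "A \<subseteq> {-1..1}" "card A \<ge> 2"
    and F: "\<And>t. t \<in> {-1..1} \<Longrightarrow> F t = F (-1) + integral {-1..t} f"
    and f: "f integrable_on {-1..1}"
  shows "((\<lambda>t. divdiff A (indicator {t..}) * f t) has_integral divdiff A F) {-1..1}"
proof -
  define w where "w a = 1 / (\<Prod>b\<in>A - {a}. a - b)" for a
  have divdiff: "divdiff A g = (\<Sum>a\<in>A. w a * g a)" for g by (simp add: divdiff_def w_def)
  have "((\<lambda>t. indicator {t..} a * f t) has_integral integral {-1..a} f) {-1..1}" if a: "a \<in> A" for a
  proof -
    have a1: "-1 \<le> a" "a \<le> 1" using a A by auto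
    have "(f has_integral integral {-1..a} f) {-1..a}"
      using integrable_subinterval_real[OF f] a1 by (intro integrable_integral) auto
    then have "((\<lambda>t. if t \<in> {-1..a} then f t else 0) has_integral integral {-1..a} f) {-1..1}"
      using a1 by (subst has_integral_restrict) auto
    then show ?thesis
      by (rule has_integral_eq[rotated]) (auto simp: indicator_def)
  qed
  then have "((\<lambda>t. \<Sum>a\<in>A. w a * (indicator {t..} a * f t)) has_integral (\<Sum>a\<in>A. w a * integral {-1..a} f)) {-1..1}"
    using A by (intro has_integral_sum has_integral_mult_right) auto
  moreover have "(\<Sum>a\<in>A. w a * integral {-1..a} f) = divdiff A F"
  proof -
    have "divdiff A F = divdiff A (\<lambda>a. F (-1) + integral {-1..a} f)"
      using A F by (intro divdiff_cong) blast
    also have "\<dots> = divdiff A (\<lambda>_. F (-1)) + divdiff A (\<lambda>a. integral {-1..a} f)" by (rule divdiff_add)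
    finally show ?thesis using divdiff_const[OF A(1,3)] by (simp add: divdiff)
  qed
  ultimately show ?thesis by (simp add: divdiff sum_distrib_right mult.assoc)
qed

text \<open>The weight that dominates the divided difference belongs to some node \<open>a\<close>
  other than \<open>y\<close>; multiplied by the nodal product it is exactly the absolute Lagrange
  value of \<open>a\<close> at \<open>y\<close>.\<close>

lemma divdiff_step_bound:
  assumes "finite X" "y \<notin> X" "X \<noteq> {}" and M: "\<And>a. a \<in> X \<Longrightarrow> \<bar>poly (lagrange_poly X a) y\<bar> \<le> M"
  shows "\<bar>(\<Prod>a\<in>X. y - a) * divdiff (insert y X) (indicator {t..})\<bar> \<le> M"
proof -
  let ?A = "insert y X"
  have "card ?A \<ge> 2" using assms by (simp add: Suc_le_eq card_gt_0_iff)
  moreover have "divdiff ?A (indicator {t..}) = divdiff ?A (indicator {a\<in>?A. t \<le> a})"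
    by (rule divdiff_cong) (simp add: indicator_def)
  ultimately obtain a where a: "a \<in> ?A - {y}"
    and le: "\<bar>divdiff ?A (indicator {t..})\<bar> \<le> 1 / \<bar>\<Prod>b\<in>?A - {a}. a - b\<bar>"
    using divdiff_upper_set_bound[of ?A y "{a\<in>?A. t \<le> a}"] assms(1) by fastforce
  have aX: "a \<in> X" "a \<noteq> y" using a by auto
  have "(\<Prod>b\<in>X. y - b) = (y - a) * (\<Prod>b\<in>X - {a}. y - b)"
    using assms aX by (intro prod.remove) auto
  moreover have "(\<Prod>b\<in>?A - {a}. a - b) = (a - y) * (\<Prod>b\<in>X - {a}. a - b)"
    using assms aX by (subst insert_Diff_if) auto
  ultimately have "\<bar>\<Prod>b\<in>X. y - b\<bar> * (1 / \<bar>\<Prod>b\<in>?A - {a}. a - b\<bar>) = \<bar>poly (lagrange_poly X a) y\<bar>"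
    using aX by (simp add: poly_lagrange_poly prod_dividef abs_mult abs_minus_commute)
  then show ?thesis
    using mult_left_mono[OF le, of "\<bar>\<Prod>b\<in>X. y - b\<bar>"] M[OF aX(1)] by (simp add: abs_mult)
qed

lemma lagrange_basis_eq:
  assumes "j \<in> {1..n}" "inj_on x {1..n}"
  shows "poly (lagrange_basis n x j) = poly (lagrange_poly (x ` {1..n}) (x j))"
proof
  fix y
  have "x ` {1..n} - {x j} = x ` ({1..n} - {j})"
    using inj_on_image_set_diff[OF assms(2), of "{1..n}" "{j}"] assms(1) by auto
  then have "poly (lagrange_poly (x ` {1..n}) (x j)) y = (\<Prod>i\<in>{1..n} - {j}. (y - x i) / (x j - x i))"
    unfolding poly_lagrange_poly using assms(2)
    by (simp add: prod.reindex inj_on_subset[OF assms(2)])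
  then show "poly (lagrange_basis n x j) y = poly (lagrange_poly (x ` {1..n}) (x j)) y"
    unfolding lagrange_basis_def nodal_poly_div(2)[OF assms(1)] poly_pderiv_nodal[OF assms(1)]
    by (simp add: poly_prod prod_dividef)
qed

text \<open>The error is the integral of the first kernel against \<open>F 1\<close>; parts turn
  this into the kernel of order \<open>r\<close> against \<open>F r\<close>, and the bounded
  variation of \<open>F r\<close> pays for one more tail integral.\<close>

lemma interpolation_error_bound:
  fixes F :: "nat \<Rightarrow> real \<Rightarrow> real"
  assumes X: "finite X" "X \<subseteq> {-1..1}" "card X = n" and y: "y \<in> {-1..1}" "y \<notin> X"
    and r: "1 \<le> r" "r + 1 \<le> n"
    and M: "\<And>a. a \<in> X \<Longrightarrow> \<bar>poly (lagrange_poly X a) y\<bar> \<le> M"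
    and F: "\<And>i t. i < r \<Longrightarrow> t \<in> {-1..1} \<Longrightarrow> F i t = F i (-1) + integral {-1..t} (F (Suc i))"
    and Fint: "\<And>i. i \<le> r \<Longrightarrow> F i integrable_on {-1..1}"
    and bv: "bounded_variation_on (-1) 1 (F r)"
  shows "\<bar>F 0 y - (\<Sum>a\<in>X. F 0 a * poly (lagrange_poly X a) y)\<bar>
     \<le> pi ^ r * total_variation (-1) 1 (F r) / (\<Prod>k=1..r. real n - real k) * M"
proof -
  let ?A = "insert y X" and ?\<omega> = "\<Prod>a\<in>X. y - a"
  define k where "k t = ?\<omega> * divdiff ?A (indicator {t..})" for t
  \<comment> \<open>The \<open>n + 1\<close> points of \<open>?A\<close> annihilate degree at most
    \<open>n - 1\<close>. The kernel acts on derivatives, which lowers this to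
    \<open>n - 2\<close>.\<close>
  define d where "d = n - 2"
  have A: "finite ?A" "?A \<subseteq> {-1..1}" "card ?A = n + 1" using X y by auto
  have A2: "card ?A \<ge> 2" using A r by simp
  have B: "\<bar>k t\<bar> \<le> M" for t
    unfolding k_def using X y r by (intro divdiff_step_bound M) auto
  have kern: "((\<lambda>t. k t * f t) has_integral ?\<omega> * divdiff ?A G) {-1..1}"
    if "\<And>t. t \<in> {-1..1} \<Longrightarrow> G t = G (-1) + integral {-1..t} f" "f integrable_on {-1..1}" for f G
    using has_integral_mult_right[OF divdiff_step_kernel[OF A(1,2) A2 that], of ?\<omega>]
    by (simp add: k_def mult.assoc)
  \<comment> \<open>The identity function with density 1 turns the representation into integrability
    of the kernel itself.\<close>
  have k: "k integrable_on {-1..1}"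
    using kern[of "\<lambda>t. t" "\<lambda>_. 1"] by (auto simp: integrable_on_def)
  have orth: "integral {-1..1} (\<lambda>t. k t * poly p t) = 0" if p: "degree p \<le> d" for p
  proof -
    obtain Q where Q: "pderiv Q = p" "degree Q \<le> Suc (degree p)" using poly_antiderivative by blast
    have "((\<lambda>t. k t * poly p t) has_integral ?\<omega> * divdiff ?A (poly Q)) {-1..1}"
    proof (rule kern)
      show "poly Q t = poly Q (-1) + integral {-1..t} (poly p)" if "t \<in> {-1..1}" for t
        using has_integral_poly_pderiv[of "-1" t Q] that by (simp add: Q integral_unique)
    qed (rule integrable_poly_Icc)
    moreover have "divdiff ?A (poly Q) = 0"
      using A Q p r by (intro divdiff_poly) (auto simp: d_def)
    ultimately show ?thesis by (simp add: integral_unique)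
  qed
  have Fbd: "bounded (F i ` {-1..1})" if "i \<le> r" for i
  proof (cases "i = r")
    case True
    then show ?thesis using bounded_variation_bounded[OF bv] by simp
  next
    case False
    then have i: "i < r" using that by simp
    have "continuous_on {-1..1} (\<lambda>t. F i (-1) + integral {-1..t} (F (Suc i)))"
      using i by (intro continuous_intros indefinite_integral_continuous_1 Fint) simp
    then have "continuous_on {-1..1} (F i)"
      by (rule continuous_on_cong[THEN iffD1, rotated -1]) (auto simp: F[OF i, symmetric])
    then show ?thesis by (intro compact_imp_bounded compact_continuous_image) auto
  qed
  \<comment> \<open>Integration by parts stops at \<open>r - 1\<close> tails; of the
    \<open>r\<close>-th tail only the size enters, which matters when
    \<open>r = Suc d\<close>.\<close>
  define s where "s = r - 1"
  have s: "r = Suc s" "s \<le> d" using r by (auto simp: s_def d_def)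
  let ?h = "iterated_tail k s" and ?C = "M * (\<Prod>i<r. pi / real (Suc d - i))"
  have zero: "integral {-1..1} ?h = 0"
  proof -
    have "integral {-1..1} (\<lambda>t. ?h t * poly 1 t) = 0"
      using s by (intro iterated_tail_properties(3)[of k M d s, OF k B]) (auto intro: orth)
    then show ?thesis by simp
  qed
  have "F 0 y - (\<Sum>a\<in>X. F 0 a * poly (lagrange_poly X a) y) = ?\<omega> * divdiff ?A (F 0)"
    using X y by (intro interpolation_error_divdiff)
  also have "\<dots> = integral {-1..1} (\<lambda>t. k t * F (Suc 0) t)"
    using r by (intro integral_unique[symmetric] kern F Fint) auto
  also have "\<dots> = integral {-1..1} (\<lambda>t. ?h t * F (Suc s) t)"
    using s by (intro iterated_tail_by_parts[of k M d s "\<lambda>i. F (Suc i)"] k B orth F Fint Fbd) auto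
  finally have e: "F 0 y - (\<Sum>a\<in>X. F 0 a * poly (lagrange_poly X a) y) = integral {-1..1} (\<lambda>t. ?h t * F r t)"
    by (simp add: s)
  have "\<bar>integral {-1..1} (\<lambda>t. ?h t * F r t)\<bar> \<le> ?C * total_variation (-1) 1 (F r)"
  proof (rule bounded_variation_integral_bound[OF bv _ _ _ zero])
    show "?h integrable_on {-1..1}"
      using s by (intro iterated_tail_properties(1)[of k M d s, OF k B]) (auto intro: orth)
    show "\<bar>integral {t..1} ?h\<bar> \<le> ?C" if "t \<in> {-1..1}" for t
    proof -
      have "\<bar>iterated_tail k r t\<bar> \<le> ?C"
        using that s by (intro iterated_tail_properties(2)[of k M d r, OF k B]) (auto intro: orth)
      then show ?thesis by (simp add: s)
    qed
  qed simp
  also have "(\<Prod>i<r. pi / real (Suc d - i)) = pi ^ r / (\<Prod>k=1..r. real n - real k)"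
  proof -
    have "(\<Prod>i<r. real (Suc d - i)) = (\<Prod>k=1..r. real n - real k)"
      by (rule prod.reindex_bij_witness[of _ "\<lambda>k. k - 1" Suc]) (use r in \<open>auto simp: d_def of_nat_diff\<close>)
    then show ?thesis by (simp add: prod_dividef)
  qed
  finally show ?thesis unfolding e by (simp add: mult_ac)
qed

section \<open>The chain of derivatives and the infimum over densities\<close>

text \<open>The gauge integral recovers a function from its derivative at once, so each derivative
  in the chain is a density of the one before.\<close>

lemma nth_deriv_on_integral:
  assumes "times_differentiable_on m f {-1..1}" "j < m" "t \<in> {-1..1}"
  shows "(nth_deriv_on {-1..1} (Suc j) f has_integral
     nth_deriv_on {-1..1} j f t - nth_deriv_on {-1..1} j f (-1)) {-1..t}"
proof (rule fundamental_theorem_of_calculus)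
  show "-1 \<le> t" using assms by simp
  fix u assume u: "u \<in> {-1..t}"
  then have "nth_deriv_on {-1..1} j f differentiable (at u within {-1..1})"
    using assms unfolding times_differentiable_on_def differentiable_on_def by auto
  then have "(nth_deriv_on {-1..1} j f has_vector_derivative nth_deriv_on {-1..1} (Suc j) f u) (at u within {-1..1})"
    by (simp add: vector_derivative_works)
  then show "(nth_deriv_on {-1..1} j f has_vector_derivative nth_deriv_on {-1..1} (Suc j) f u) (at u within {-1..t})"
    by (rule has_vector_derivative_within_subset) (use assms in auto)
qed

theorem theorem3p2:
  fixes f :: "real \<Rightarrow> real" and r n :: nat and x :: "nat \<Rightarrow> real"
  assumes "r \<ge> 1"
    and "times_differentiable_on (r - 1) f {-1..1}"
    and "absolutely_continuous_on_interval (-1) 1 (nth_deriv_on {-1..1} (r - 1) f)"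
    and "\<exists>g. g \<in> bv_densities r f"
    and "n \<ge> r + 1"
    and "-1 \<le> x n" and "x 1 \<le> 1"
    and "\<And>i j. 1 \<le> i \<Longrightarrow> i < j \<Longrightarrow> j \<le> n \<Longrightarrow> x j < x i"
  shows "sup_norm (interp_error n x f)
    \<le> pi ^ r * min_variation r f / (\<Prod>k=1..r. real n - real k)
        * (MAX j\<in>{1..n}. sup_norm (poly (lagrange_basis n x j)))"
proof -
  define M where "M = (MAX j\<in>{1..n}. sup_norm (poly (lagrange_basis n x j)))"
  define P where "P = (\<Prod>k=1..r. real n - real k)"
  define X where "X = x ` {1..n}"
  have n: "n \<ge> 2" using assms by simp
  have inj: "inj_on x {1..n}"
    by (rule inj_onI) (metis assms(8) atLeastAtMost_iff linorder_neqE_nat order_less_irrefl)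
  have x_in: "x j \<in> {-1..1}" if "j \<in> {1..n}" for j
  proof -
    have "x j \<le> x 1" using assms(8)[of 1 j] that by (cases "j = 1") auto
    moreover have "x n \<le> x j" using assms(8)[of j n] that by (cases "j = n") auto
    ultimately show ?thesis using assms(6,7) by auto
  qed
  have X: "finite X" "X \<subseteq> {-1..1}" "card X = n"
    using x_in card_image[OF inj] by (auto simp: X_def)
  have basis_le: "\<bar>poly (lagrange_basis n x j) y\<bar> \<le> M" if "j \<in> {1..n}" "y \<in> {-1..1}" for j y
  proof -
    have "bounded ((\<lambda>y. \<bar>poly (lagrange_basis n x j) y\<bar>) ` {-1..1})"
      by (intro compact_imp_bounded compact_continuous_image continuous_intros) auto
    then have "\<bar>poly (lagrange_basis n x j) y\<bar> \<le> sup_norm (poly (lagrange_basis n x j))"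
      unfolding sup_norm_def using that by (intro cSUP_upper bounded_imp_bdd_above)
    also have "\<dots> \<le> M" unfolding M_def using that by (intro Max_ge) auto
    finally show ?thesis .
  qed
  \<comment> \<open>A basis polynomial takes the value 1 at its own node; the resulting positivity
    permits division by \<open>M\<close> below.\<close>
  have M1: "M \<ge> 1"
    using basis_le[of 1 "x 1"] poly_lagrange_basis_node[of 1 n 1 x] inj x_in[of 1] n by simp
  have P0: "P > 0" unfolding P_def using assms(5) by (intro prod_pos) auto
  have bound: "\<bar>interp_error n x f y\<bar> \<le> pi ^ r * total_variation (-1) 1 g / P * M"
    if g: "g \<in> bv_densities r f" and y: "y \<in> {-1..1}" for g y
  proof (cases "y \<in> X")
    case True
    then obtain i where i: "i \<in> {1..n}" "y = x i" by (auto simp: X_def)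
    have "(\<Sum>j=1..n. f (x j) * poly (lagrange_basis n x j) y) = (\<Sum>j=1..n. if j = i then f (x i) else 0)"
      using i inj by (intro sum.cong) (auto simp: poly_lagrange_basis_node)
    also have "\<dots> = f y" using i by simp
    finally have "interp_error n x f y = 0" by (simp add: interp_error_def)
    moreover have "0 \<le> total_variation (-1) 1 g"
      using g unfolding bv_densities_def by (intro total_variation_nonneg[of "-1" 1]) (blast | simp)+
    ultimately show ?thesis using M1 P0 by simp
  next
    case False
    define F where "F i = (if i < r then nth_deriv_on {-1..1} i f else g)" for i
    have gint: "g integrable_on {-1..1}" and bv: "bounded_variation_on (-1) 1 g"
      and gr: "\<And>t. t \<in> {-1..1} \<Longrightarrow> nth_deriv_on {-1..1} (r - 1) f t = nth_deriv_on {-1..1} (r - 1) f (-1) + integral {-1..t} g"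
      using g unfolding bv_densities_def by (blast intro: set_lebesgue_integral_eq_integral(1))+
    have F: "F i t = F i (-1) + integral {-1..t} (F (Suc i))" if i: "i < r" and t: "t \<in> {-1..1}" for i t
    proof (cases "Suc i = r")
      case True
      then show ?thesis using gr[OF t] by (auto simp: F_def)
    next
      case False
      then have "i < r - 1" using i by simp
      from nth_deriv_on_integral[OF assms(2) this t] show ?thesis
        using i False by (simp add: F_def integral_unique del: nth_deriv_on.simps)
    qed
    have Fint: "F i integrable_on {-1..1}" if i: "i \<le> r" for i
    proof -
      consider "i < r - 1" | "i = r - 1" | "i = r" using i assms(1) by linarith
      then show ?thesis
      proof cases
        case 1
        then have "continuous_on {-1..1} (nth_deriv_on {-1..1} i f)"
          using assms(2) unfolding times_differentiable_on_def by (intro differentiable_imp_continuous_on) auto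
        then show ?thesis using 1 by (auto simp: F_def intro: integrable_continuous_interval)
      next
        \<comment> \<open>Differentiability is assumed only for orders below \<open>r - 1\<close>;
          at this order continuity comes from the integral representation by
          \<open>g\<close>.\<close>
        case 2
        have "continuous_on {-1..1} (\<lambda>t. nth_deriv_on {-1..1} (r - 1) f (-1) + integral {-1..t} g)"
          by (intro continuous_intros indefinite_integral_continuous_1 gint)
        then have "(\<lambda>t. nth_deriv_on {-1..1} (r - 1) f (-1) + integral {-1..t} g) integrable_on {-1..1}"
          by (rule integrable_continuous_interval)
        then have "nth_deriv_on {-1..1} (r - 1) f integrable_on {-1..1}"
          by (rule integrable_eq) (rule gr[symmetric])
        then show ?thesis using 2 assms(1) by (simp add: F_def)
      next
        case 3
        then show ?thesis using gint by (simp add: F_def)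
      qed
    qed
    have "\<bar>F 0 y - (\<Sum>a\<in>X. F 0 a * poly (lagrange_poly X a) y)\<bar>
       \<le> pi ^ r * total_variation (-1) 1 (F r) / (\<Prod>k=1..r. real n - real k) * M"
    proof (rule interpolation_error_bound[OF X y False assms(1,5)])
      show "\<bar>poly (lagrange_poly X a) y\<bar> \<le> M" if "a \<in> X" for a
        using that basis_le[OF _ y] lagrange_basis_eq[OF _ inj] by (auto simp: X_def)
      show "F i t = F i (-1) + integral {-1..t} (F (Suc i))" if "i < r" "t \<in> {-1..1}" for i t
        by (rule F[OF that])
      show "F i integrable_on {-1..1}" if "i \<le> r" for i
        by (rule Fint[OF that])
      show "bounded_variation_on (-1) 1 (F r)" using bv by (simp add: F_def)
    qed
    moreover have "(\<Sum>a\<in>X. F 0 a * poly (lagrange_poly X a) y) = (\<Sum>j=1..n. f (x j) * poly (lagrange_basis n x j) y)"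
      unfolding X_def using assms(1) inj by (subst sum.reindex) (auto simp: F_def lagrange_basis_eq)
    ultimately show ?thesis using assms(1) by (simp add: interp_error_def F_def P_def)
  qed
  \<comment> \<open>Division by the positive constant turns the estimate for each \<open>g\<close>
    into a lower bound for all the variations, hence for their infimum, which need not be
    attained.\<close>
  have "sup_norm (interp_error n x f) / (pi ^ r / P * M) \<le> min_variation r f"
    unfolding min_variation_def
  proof (rule cINF_greatest)
    show "bv_densities r f \<noteq> {}" using assms(4) by blast
    fix g assume g: "g \<in> bv_densities r f"
    have "sup_norm (interp_error n x f) \<le> pi ^ r * total_variation (-1) 1 g / P * M"
      unfolding sup_norm_def by (rule cSUP_least) (simp, rule bound[OF g])
    then show "sup_norm (interp_error n x f) / (pi ^ r / P * M) \<le> total_variation (-1) 1 g"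
      using P0 M1 by (simp add: divide_simps mult_ac)
  qed
  then show ?thesis
    unfolding M_def[symmetric] P_def[symmetric] using P0 M1 by (simp add: divide_simps mult_ac)
qed

end
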